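(* Assume the setting of nonconforming test spaces described in the context, and fix $\varepsilon_0>0$. For $\delta\in I$, $\varepsilon\in[0,\varepsilon_0]$ and $(\ell^\delta,q)\in(Y^\delta)'\times L_2(\omega)$, let $$u_\varepsilon^\delta:=\operatorname*{argmin}_{z\in X^\delta}\big\{\|B^\delta z-\ell^\delta\|_{(Y^\delta)'}^2+\|Cz-q\|_{L_2(\omega)}^2+\varepsilon^2\|z\|_{L_2(\Omega)}^2\big\}.$$ (a) There is a constant $K$, independent of $\delta\in I$, $\varepsilon\in[0,\varepsilon_0]$, $\ell,\ell^\delta,q,u$, such that for all $\ell\in H^{-2}(\Omega)$, $(\ell^\delta,q)\in(Y^\delta)'\times L_2(\omega)$ and $u\in L_2(\Omega)$, $$\begin{aligned}\|A(u-u_\varepsilon^\delta)\|_{H^{-2}(\Omega)\times L_2(\omega)}&+\varepsilon\|u-u_\varepsilon^\delta\|_{L_2(\Omega)}\le K\Big[\|Au-(\ell,q)\|_{H^{-2}(\Omega)\times L_2(\omega)}+\varepsilon\|u\|_{L_2(\Omega)}\\&+\min_{z\in X^\delta}\Big\{\|u-z\|_{L_2(\Omega)}+\sup_{0\neq v\in Y^\delta}\frac{|(B^\delta z)(v-E^\delta v)+\ell(E^\delta v)-\ell^\delta(v)|}{\|v\|_{Y^\delta}}\Big\}\Big].\end{aligned}$$ (b) Consequently, if, in addition, for some quantity $\mathrm{osc}_\delta(\ell)\ge0$ and a constant $C_1$ (independent of $\delta$), it holds for all $z\in X^\delta$ that $$\sup_{0\neq v\in Y^\delta}\frac{|(B^\delta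 z)(v-E^\delta v)+\ell(E^\delta v)-\ell^\delta(v)|}{\|v\|_{Y^\delta}}\le C_1\big(\|\ell-Bu\|_{H^{-2}(\Omega)}+\|u-z\|_{L_2(\Omega)}+\mathrm{osc}_\delta(\ell)\big),$$ then, with a constant $K'$ depending only on $K$ and $C_1$, $$\|A(u-u_\varepsilon^\delta)\|_{H^{-2}(\Omega)\times L_2(\omega)}+\varepsilon\|u-u_\varepsilon^\delta\|_{L_2(\Omega)}\le K'\big(\mathcal{E}_{\rm data}+\mathcal{E}_{\rm appr}(\delta)+\mathrm{osc}_\delta(\ell)+\varepsilon\|u\|_{L_2(\Omega)}\big),$$ where $\mathcal{E}_{\rm data}:=\|Au-(\ell,q)\|_{H^{-2}(\Omega)\times L_2(\omega)}$ and $\mathcal{E}_{\rm appr}(\delta):=\min_{z\in X^\delta}\|u-z\|_{L_2(\Omega)}$.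
   Context: All spaces are real. $\emptyset\neq\omega\Subset\Omega\subset\mathbb{R}^n$ are bounded domains (open connected sets, $\overline\omega$ a compact subset of $\Omega$). $H^{-2}(\Omega)=(H^2_0(\Omega))'$. The operator $A=(B,C)\in\mathcal{L}(L_2(\Omega),H^{-2}(\Omega)\times L_2(\omega))$ is $(Bz)(v):=-\int_\Omega z\,\Delta v\,dx$ ($v\in H^2_0(\Omega)$), $Cz:=z|_\omega$; the norm on the product is $(\|\cdot\|_{H^{-2}(\Omega)}^2+\|\cdot\|_{L_2(\omega)}^2)^{1/2}$. Setting of nonconforming test spaces: $(X^\delta)_{\delta\in I}$ is a family of finite dimensional subspaces of $L_2(\Omega)$. $(Y^\delta)_{\delta\in I}$ is a family of finite dimensional Hilbert spaces (of functions on $\Omega$), not necessarily contained in $H^2_0(\Omega)$, with norms $\|\cdot\|_{Y^\delta}$. There are given: (i) operators $E^\delta\in\mathcal{L}(Y^\delta,H^2_0(\Omega))$ with $\sup_{\delta\in I}\|E^\delta\|_{\mathcal{L}(Y^\delta,H^2_0(\Omega))}<\infty$; (ii) operators $B^\delta\in\mathcal{L}\big(L_2(\Omega),(H^2_0(\Omega)+Y^\delta)'\big)$ with $(B^\delta z)(v)=(Bz)(v)$ for all $z\in L_2(\Omega)$, $v\in H^2_0(\Omega)$; (iii) (generalized Fortin) operators $Q^\delta\in\mathcal{L}(H^2_0(\Omega),Y^\delta)$ with $\sup_{\delta\in I}\|Q^\delta\|_{\mathcal{L}(H^2_0(\Omega),Y^\delta)}<\infty$ and $(B^\delta z)(v-Q^\delta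 v)=0$ for all $z\in X^\delta$, $v\in H^2_0(\Omega)$. The norm on $(Y^\delta)'$ is $\|f\|_{(Y^\delta)'}=\sup_{0\neq v\in Y^\delta}|f(v)|/\|v\|_{Y^\delta}$. *)

theory Defs
  imports "HOL-Analysis.Analysis"
begin

definition ae_eq :: "(real^'n \<Rightarrow> real) \<Rightarrow> (real^'n \<Rightarrow> real) \<Rightarrow> bool" where
  "ae_eq f g \<longleftrightarrow> (AE x in lebesgue. f x = g x)"

lemma ae_eq_equivp: "equivp ae_eq"
proof (rule equivpI)
  show "reflp ae_eq" by (simp add: reflp_def ae_eq_def)
  show "symp ae_eq" by (simp add: symp_def ae_eq_def eq_commute)
  show "transp ae_eq" unfolding transp_def ae_eq_def by (auto elim: AE_mp)
qed

quotient_type 'n aefun = "real^'n \<Rightarrow> real" / ae_eq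
  morphisms rep_ae ae_class
  by (rule ae_eq_equivp)

instantiation aefun :: (finite) real_vector
begin

lift_definition zero_aefun :: "'a aefun" is "\<lambda>x. 0" .

lift_definition plus_aefun :: "'a aefun \<Rightarrow> 'a aefun \<Rightarrow> 'a aefun" is "\<lambda>f g x. f x + g x"
  unfolding ae_eq_def by (auto elim: AE_mp)

lift_definition minus_aefun :: "'a aefun \<Rightarrow> 'a aefun \<Rightarrow> 'a aefun" is "\<lambda>f g x. f x - g x"
  unfolding ae_eq_def by (auto elim: AE_mp)

lift_definition uminus_aefun :: "'a aefun \<Rightarrow> 'a aefun" is "\<lambda>f x. - f x"
  unfolding ae_eq_def by (auto elim: AE_mp)

lift_definition scaleR_aefun :: "real \<Rightarrow> 'a aefun \<Rightarrow> 'a aefun" is "\<lambda>c f x. c * f x"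
  unfolding ae_eq_def by (auto elim: AE_mp)

instance
  by standard (transfer; simp add: ae_eq_def algebra_simps)+

end

definition finite_dim_subspace :: "'v::real_vector set \<Rightarrow> bool" where
  "finite_dim_subspace V \<longleftrightarrow> (\<exists>S. finite S \<and> V = span S)"

definition lin_on :: "'v::real_vector set \<Rightarrow> ('v \<Rightarrow> 'w::real_vector) \<Rightarrow> bool" where
  "lin_on V T \<longleftrightarrow> (\<forall>x\<in>V. \<forall>y\<in>V. \<forall>a b. T (a *\<^sub>R x + b *\<^sub>R y) = a *\<^sub>R T x + b *\<^sub>R T y)"

definition bounded_ops ::
  "'v::real_vector set \<Rightarrow> ('v \<Rightarrow> real) \<Rightarrow> 'w::real_vector set \<Rightarrow> ('w \<Rightarrow> real) \<Rightarrow> ('v \<Rightarrow> 'w) set" where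
  "bounded_ops V nV W nW =
     {T. T ` V \<subseteq> W \<and> lin_on V T \<and> (\<exists>K. \<forall>v\<in>V. nW (T v) \<le> K * nV v)}"

text \<open>In \<open>op_norm\<close> and \<open>dual_norm\<close> the vector \<open>v = 0\<close> is not excluded: as \<open>0 / 0 = 0\<close>, it
  contributes the value \<open>0\<close>, so that the supremum is also meaningful on the trivial space.\<close>

definition op_norm ::
  "'v::real_vector set \<Rightarrow> ('v \<Rightarrow> real) \<Rightarrow> ('w::real_vector \<Rightarrow> real) \<Rightarrow> ('v \<Rightarrow> 'w) \<Rightarrow> real" where
  "op_norm V nV nW T = (SUP v\<in>V. nW (T v) / nV v)"

text \<open>Functionals are represented by functions on the whole type; only their values on \<open>V\<close>
  matter.\<close>

definition dual :: "'v::real_vector set \<Rightarrow> ('v \<Rightarrow> real) \<Rightarrow> ('v \<Rightarrow> real) set" where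
  "dual V nV = {f. lin_on V f \<and> (\<exists>K. \<forall>v\<in>V. \<bar>f v\<bar> \<le> K * nV v)}"

definition dual_norm :: "'v::real_vector set \<Rightarrow> ('v \<Rightarrow> real) \<Rightarrow> ('v \<Rightarrow> real) \<Rightarrow> real" where
  "dual_norm V nV f = (SUP v\<in>V. \<bar>f v\<bar> / nV v)"

definition inner_product_on :: "'v::real_vector set \<Rightarrow> ('v \<Rightarrow> 'v \<Rightarrow> real) \<Rightarrow> bool" where
  "inner_product_on V ip \<longleftrightarrow>
     (\<forall>v\<in>V. lin_on V (ip v)) \<and> (\<forall>v\<in>V. \<forall>w\<in>V. ip v w = ip w v) \<and>
     (\<forall>v\<in>V. v \<noteq> 0 \<longrightarrow> 0 < ip v v)"

definition ip_norm :: "('v \<Rightarrow> 'v \<Rightarrow> real) \<Rightarrow> 'v \<Rightarrow> real" where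
  "ip_norm ip v = sqrt (ip v v)"

definition set_sum :: "'v::real_vector set \<Rightarrow> 'v set \<Rightarrow> 'v set" where
  "set_sum V W = {v + w | v w. v \<in> V \<and> w \<in> W}"

definition sum_norm ::
  "'v::real_vector set \<Rightarrow> ('v \<Rightarrow> real) \<Rightarrow> 'v set \<Rightarrow> ('v \<Rightarrow> real) \<Rightarrow> 'v \<Rightarrow> real" where
  "sum_norm V nV W nW x = Inf {nV v + nW w | v w. v \<in> V \<and> w \<in> W \<and> x = v + w}"

text \<open>A function on \<open>\<Omega>\<close> is identified with its extension by zero to the whole space.\<close>

definition functions_on :: "(real^'n) set \<Rightarrow> 'n::finite aefun set" where
  "functions_on \<Omega> = {f. AE x in lebesgue. x \<notin> \<Omega> \<longrightarrow> rep_ae f x = 0}"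

definition restrict_ae :: "(real^'n) set \<Rightarrow> 'n::finite aefun \<Rightarrow> 'n aefun" where
  "restrict_ae S f = ae_class (\<lambda>x. indicator S x * rep_ae f x)"

definition L2 :: "(real^'n) set \<Rightarrow> 'n::finite aefun set" where
  "L2 \<Omega> = {f \<in> functions_on \<Omega>. rep_ae f \<in> borel_measurable lebesgue \<and>
                             integrable lebesgue (\<lambda>x. (rep_ae f x)\<^sup>2)}"

definition L2_nrm :: "'n::finite aefun \<Rightarrow> real" where
  "L2_nrm f = sqrt (LINT x|lebesgue. (rep_ae f x)\<^sup>2)"

definition partial :: "'n \<Rightarrow> (real^'n \<Rightarrow> real) \<Rightarrow> real^'n::finite \<Rightarrow> real" where
  "partial i f x = frechet_derivative f (at x) (axis i 1)"

primrec Ck :: "nat \<Rightarrow> (real^'n::finite \<Rightarrow> real) \<Rightarrow> bool" where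
  "Ck 0 f \<longleftrightarrow> continuous_on UNIV f"
| "Ck (Suc k) f \<longleftrightarrow> (\<forall>x. f differentiable (at x)) \<and> (\<forall>i. Ck k (partial i f))"

definition test_functions :: "(real^'n) set \<Rightarrow> (real^'n::finite \<Rightarrow> real) set" where
  "test_functions \<Omega> =
     {\<phi>. (\<forall>k. Ck k \<phi>) \<and> compact (closure {x. \<phi> x \<noteq> 0}) \<and> closure {x. \<phi> x \<noteq> 0} \<subseteq> \<Omega>}"

definition is_weak_deriv :: "(real^'n) set \<Rightarrow> 'n \<Rightarrow> 'n::finite aefun \<Rightarrow> 'n aefun \<Rightarrow> bool" where
  "is_weak_deriv \<Omega> i f g \<longleftrightarrow> f \<in> L2 \<Omega> \<and> g \<in> L2 \<Omega> \<and>
     (\<forall>\<phi>\<in>test_functions \<Omega>.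
        (LINT x:\<Omega>|lebesgue. rep_ae f x * partial i \<phi> x) = - (LINT x:\<Omega>|lebesgue. rep_ae g x * \<phi> x))"

text \<open>The weak derivative is unique as an element of \<open>L2 \<Omega>\<close>, so the choice operator does not
  choose.\<close>

definition weak_deriv :: "(real^'n) set \<Rightarrow> 'n \<Rightarrow> 'n::finite aefun \<Rightarrow> 'n aefun" where
  "weak_deriv \<Omega> i f = (SOME g. is_weak_deriv \<Omega> i f g)"

definition H2 :: "(real^'n) set \<Rightarrow> 'n::finite aefun set" where
  "H2 \<Omega> = {f \<in> L2 \<Omega>. \<forall>i. (\<exists>g. is_weak_deriv \<Omega> i f g) \<and>
                       (\<forall>j. \<exists>h. is_weak_deriv \<Omega> j (weak_deriv \<Omega> i f) h)}"

definition H2_nrm :: "(real^'n) set \<Rightarrow> 'n::finite aefun \<Rightarrow> real" where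
  "H2_nrm \<Omega> f = sqrt ((L2_nrm f)\<^sup>2 + (\<Sum>i\<in>UNIV. (L2_nrm (weak_deriv \<Omega> i f))\<^sup>2) +
     (\<Sum>i\<in>UNIV. \<Sum>j\<in>UNIV. (L2_nrm (weak_deriv \<Omega> j (weak_deriv \<Omega> i f)))\<^sup>2))"

definition H20 :: "(real^'n) set \<Rightarrow> 'n::finite aefun set" where
  "H20 \<Omega> = {v \<in> H2 \<Omega>. \<forall>e>0. \<exists>\<phi>\<in>test_functions \<Omega>. H2_nrm \<Omega> (v - ae_class \<phi>) < e}"

definition laplacian :: "(real^'n) set \<Rightarrow> 'n::finite aefun \<Rightarrow> 'n aefun" where
  "laplacian \<Omega> v = (\<Sum>i\<in>UNIV. weak_deriv \<Omega> i (weak_deriv \<Omega> i v))"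

abbreviation Hm2 :: "(real^'n) set \<Rightarrow> ('n::finite aefun \<Rightarrow> real) set" where
  "Hm2 \<Omega> \<equiv> dual (H20 \<Omega>) (H2_nrm \<Omega>)"

abbreviation Hm2_nrm :: "(real^'n) set \<Rightarrow> ('n::finite aefun \<Rightarrow> real) \<Rightarrow> real" where
  "Hm2_nrm \<Omega> \<equiv> dual_norm (H20 \<Omega>) (H2_nrm \<Omega>)"

definition opB :: "(real^'n) set \<Rightarrow> 'n::finite aefun \<Rightarrow> 'n aefun \<Rightarrow> real" where
  "opB \<Omega> z v = - (LINT x:\<Omega>|lebesgue. rep_ae z x * rep_ae (laplacian \<Omega> v) x)"

definition opC :: "(real^'n) set \<Rightarrow> 'n::finite aefun \<Rightarrow> 'n aefun" where
  "opC \<omega> z = restrict_ae \<omega> z"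

definition data_nrm :: "(real^'n) set \<Rightarrow> ('n::finite aefun \<Rightarrow> real) \<Rightarrow> 'n aefun \<Rightarrow> real" where
  "data_nrm \<Omega> f g = sqrt ((Hm2_nrm \<Omega> f)\<^sup>2 + (L2_nrm g)\<^sup>2)"

text \<open>\<open>Y \<delta>\<close> is a Hilbert space with inner product \<open>ip \<delta>\<close>; completeness is automatic in finite
  dimensions.  The algebraic sum of \<open>H20 \<Omega>\<close> and \<open>Y \<delta>\<close> carries the usual norm of a sum of two
  normed spaces, i.e. the infimum over all decompositions.\<close>

locale nonconforming_tests =
  fixes \<Omega> \<omega> :: "(real^'n::finite) set"
    and I :: "'i set"
    and X Y :: "'i \<Rightarrow> 'n aefun set"
    and ip :: "'i \<Rightarrow> 'n aefun \<Rightarrow> 'n aefun \<Rightarrow> real"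
    and E :: "'i \<Rightarrow> 'n aefun \<Rightarrow> 'n aefun"
    and B :: "'i \<Rightarrow> 'n aefun \<Rightarrow> 'n aefun \<Rightarrow> real"
    and Q :: "'i \<Rightarrow> 'n aefun \<Rightarrow> 'n aefun"
  assumes Omega: "open \<Omega>" "connected \<Omega>" "bounded \<Omega>"
    and omega: "open \<omega>" "connected \<omega>" "\<omega> \<noteq> {}" "compact (closure \<omega>)" "closure \<omega> \<subseteq> \<Omega>"
    and X: "\<And>\<delta>. \<delta> \<in> I \<Longrightarrow> finite_dim_subspace (X \<delta>)" "\<And>\<delta>. \<delta> \<in> I \<Longrightarrow> X \<delta> \<subseteq> L2 \<Omega>"
    and Y: "\<And>\<delta>. \<delta> \<in> I \<Longrightarrow> finite_dim_subspace (Y \<delta>)" "\<And>\<delta>. \<delta> \<in> I \<Longrightarrow> Y \<delta> \<subseteq> functions_on \<Omega>"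
      "\<And>\<delta>. \<delta> \<in> I \<Longrightarrow> inner_product_on (Y \<delta>) (ip \<delta>)"
    and E: "\<And>\<delta>. \<delta> \<in> I \<Longrightarrow> E \<delta> \<in> bounded_ops (Y \<delta>) (ip_norm (ip \<delta>)) (H20 \<Omega>) (H2_nrm \<Omega>)"
    and E_uniform: "bdd_above ((\<lambda>\<delta>. op_norm (Y \<delta>) (ip_norm (ip \<delta>)) (H2_nrm \<Omega>) (E \<delta>)) ` I)"
    and B_dual: "\<And>\<delta> z. \<delta> \<in> I \<Longrightarrow> z \<in> L2 \<Omega> \<Longrightarrow>
        B \<delta> z \<in> dual (set_sum (H20 \<Omega>) (Y \<delta>)) (sum_norm (H20 \<Omega>) (H2_nrm \<Omega>) (Y \<delta>) (ip_norm (ip \<delta>)))"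
    and B_linear: "\<And>\<delta> v. \<delta> \<in> I \<Longrightarrow> v \<in> set_sum (H20 \<Omega>) (Y \<delta>) \<Longrightarrow> lin_on (L2 \<Omega>) (\<lambda>z. B \<delta> z v)"
    and B_bounded: "\<And>\<delta>. \<delta> \<in> I \<Longrightarrow> \<exists>K. \<forall>z\<in>L2 \<Omega>.
        dual_norm (set_sum (H20 \<Omega>) (Y \<delta>)) (sum_norm (H20 \<Omega>) (H2_nrm \<Omega>) (Y \<delta>) (ip_norm (ip \<delta>))) (B \<delta> z)
          \<le> K * L2_nrm z"
    and B_consistent: "\<And>\<delta> z v. \<delta> \<in> I \<Longrightarrow> z \<in> L2 \<Omega> \<Longrightarrow> v \<in> H20 \<Omega> \<Longrightarrow> B \<delta> z v = opB \<Omega> z v"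
    and Q: "\<And>\<delta>. \<delta> \<in> I \<Longrightarrow> Q \<delta> \<in> bounded_ops (H20 \<Omega>) (H2_nrm \<Omega>) (Y \<delta>) (ip_norm (ip \<delta>))"
    and Q_uniform: "bdd_above ((\<lambda>\<delta>. op_norm (H20 \<Omega>) (H2_nrm \<Omega>) (ip_norm (ip \<delta>)) (Q \<delta>)) ` I)"
    and Q_fortin: "\<And>\<delta> z v. \<delta> \<in> I \<Longrightarrow> z \<in> X \<delta> \<Longrightarrow> v \<in> H20 \<Omega> \<Longrightarrow> B \<delta> z (v - Q \<delta> v) = 0"

definition least_squares_functional ::
  "(real^'n) set \<Rightarrow> 'n::finite aefun set \<Rightarrow> ('n aefun \<Rightarrow> 'n aefun \<Rightarrow> real) \<Rightarrow>
   ('n aefun \<Rightarrow> 'n aefun \<Rightarrow> real) \<Rightarrow> real \<Rightarrow> ('n aefun \<Rightarrow> real) \<Rightarrow> 'n aefun \<Rightarrow> 'n aefun \<Rightarrow> real" where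
  "least_squares_functional \<omega> Yd ipd Bd \<epsilon> ld q z =
     (dual_norm Yd (ip_norm ipd) (\<lambda>v. Bd z v - ld v))\<^sup>2 + (L2_nrm (opC \<omega> z - q))\<^sup>2
       + \<epsilon>\<^sup>2 * (L2_nrm z)\<^sup>2"

definition is_minimizer ::
  "(real^'n) set \<Rightarrow> 'n::finite aefun set \<Rightarrow> 'n aefun set \<Rightarrow> ('n aefun \<Rightarrow> 'n aefun \<Rightarrow> real) \<Rightarrow>
   ('n aefun \<Rightarrow> 'n aefun \<Rightarrow> real) \<Rightarrow> real \<Rightarrow> ('n aefun \<Rightarrow> real) \<Rightarrow> 'n aefun \<Rightarrow> 'n aefun \<Rightarrow> bool" where
  "is_minimizer \<omega> Xd Yd ipd Bd \<epsilon> ld q =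
     is_arg_min (least_squares_functional \<omega> Yd ipd Bd \<epsilon> ld q) (\<lambda>z. z \<in> Xd)"

definition consistency_error ::
  "'n::finite aefun set \<Rightarrow> ('n aefun \<Rightarrow> 'n aefun \<Rightarrow> real) \<Rightarrow> ('n aefun \<Rightarrow> 'n aefun) \<Rightarrow>
   ('n aefun \<Rightarrow> 'n aefun \<Rightarrow> real) \<Rightarrow> ('n aefun \<Rightarrow> real) \<Rightarrow> ('n aefun \<Rightarrow> real) \<Rightarrow> 'n aefun \<Rightarrow> real" where
  "consistency_error Yd ipd Ed Bd l ld z =
     dual_norm Yd (ip_norm ipd) (\<lambda>v. Bd z (v - Ed v) + l (Ed v) - ld v)"

definition total_error ::
  "(real^'n) set \<Rightarrow> (real^'n) set \<Rightarrow> real \<Rightarrow> 'n::finite aefun \<Rightarrow> 'n aefun \<Rightarrow> real" where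
  "total_error \<Omega> \<omega> \<epsilon> u ud =
     data_nrm \<Omega> (opB \<Omega> (u - ud)) (opC \<omega> (u - ud)) + \<epsilon> * L2_nrm (u - ud)"

definition data_error ::
  "(real^'n) set \<Rightarrow> (real^'n) set \<Rightarrow> 'n::finite aefun \<Rightarrow> ('n aefun \<Rightarrow> real) \<Rightarrow> 'n aefun \<Rightarrow> real" where
  "data_error \<Omega> \<omega> u l q = data_nrm \<Omega> (\<lambda>v. opB \<Omega> u v - l v) (opC \<omega> u - q)"

text \<open>\<open>Min\<close> is restricted to finite sets; \<open>Inf\<close> would not express that the minimum is attained.\<close>

definition min_over :: "'v set \<Rightarrow> ('v \<Rightarrow> real) \<Rightarrow> real" where
  "min_over S F = (LEAST r. r \<in> F ` S)"

definition a_priori_bound ::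
  "(real^'n) set \<Rightarrow> (real^'n) set \<Rightarrow> 'i set \<Rightarrow> ('i \<Rightarrow> 'n::finite aefun set) \<Rightarrow> ('i \<Rightarrow> 'n aefun set) \<Rightarrow>
   ('i \<Rightarrow> 'n aefun \<Rightarrow> 'n aefun \<Rightarrow> real) \<Rightarrow> ('i \<Rightarrow> 'n aefun \<Rightarrow> 'n aefun) \<Rightarrow>
   ('i \<Rightarrow> 'n aefun \<Rightarrow> 'n aefun \<Rightarrow> real) \<Rightarrow> real \<Rightarrow> real \<Rightarrow> bool" where
  "a_priori_bound \<Omega> \<omega> I X Y ip E B \<epsilon>0 K \<longleftrightarrow>
     (\<forall>\<delta>\<in>I. \<forall>\<epsilon>\<in>{0..\<epsilon>0}. \<forall>l\<in>Hm2 \<Omega>. \<forall>ld\<in>dual (Y \<delta>) (ip_norm (ip \<delta>)). \<forall>q\<in>L2 \<omega>. \<forall>u\<in>L2 \<Omega>. \<forall>ud.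
        is_minimizer \<omega> (X \<delta>) (Y \<delta>) (ip \<delta>) (B \<delta>) \<epsilon> ld q ud \<longrightarrow>
        total_error \<Omega> \<omega> \<epsilon> u ud
          \<le> K * (data_error \<Omega> \<omega> u l q + \<epsilon> * L2_nrm u +
                 min_over (X \<delta>) (\<lambda>z. L2_nrm (u - z) +
                    consistency_error (Y \<delta>) (ip \<delta>) (E \<delta>) (B \<delta>) l ld z)))"

end

theory Submission
  imports Defs
begin

text \<open>Let \<open>z\<close> attain the minimum on the right-hand side.  The Fortin operator bounds \<open>B (z - ud)\<close> in
  the dual of \<open>H20 \<Omega>\<close> by the discrete dual norm, so the error of \<open>ud\<close> is controlled by \<open>u - z\<close> and the
  energy seminorm of \<open>z - ud\<close>.  Minimality of \<open>ud\<close> bounds the latter by twice the discrete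
  least-squares residual of \<open>z\<close>, which splits into the consistency error of \<open>z\<close> and the residual
  of \<open>z\<close> tested with \<open>E v\<close>.  All minima exist because a seminorm attains its minimum on every
  translate of a finite dimensional subspace.\<close>

section \<open>Seminorms and their minima\<close>

text \<open>For \<epsilon> = 0 the least-squares functional contains no term in the norm of
  \<open>z\<close>, so bounded sublevel sets are not at hand, and \<open>'n aefun\<close> carries
  only a vector space structure. Attainment is therefore proved for arbitrary seminorms, with
  compactness used for one real coefficient at a time. The residuals are affine in \<open>z\<close>;
  an additional scalar \<open>t\<close> multiplying the data makes them linear in
  \<open>(z, t)\<close>. The same device yields quasi-optimality: the difference of
  \<open>(z, 1)\<close> and \<open>(ud, 1)\<close> is \<open>(z - ud, 0)\<close>, where the data
  have disappeared, so the triangle inequality compares the energy of \<open>z - ud\<close> with the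
  two residuals. Boundedness and linearity in \<open>z\<close> of \<open>opB\<close> are drawn from
  \<open>B \<delta>\<close>, with which it agrees on \<open>H20 \<Omega>\<close>. While
  \<open>Q\<close> carries continuous test functions to discrete ones, \<open>E\<close> goes the
  other way, into \<open>H20 \<Omega>\<close>, where the residual of \<open>u\<close> can be
  measured; the cost of this transfer is the consistency error. The bound \<epsilon>0 enters the
  constant because \<epsilon> times the norm of \<open>u - z\<close> has to be absorbed by the norm
  of \<open>u - z\<close>.\<close>

definition seminorm_on :: "'v::real_vector set \<Rightarrow> ('v \<Rightarrow> real) \<Rightarrow> bool" where
  "seminorm_on W p \<longleftrightarrow> subspace W \<and> (\<forall>x\<in>W. \<forall>y\<in>W. p (x + y) \<le> p x + p y) \<and>
     (\<forall>x\<in>W. \<forall>c. p (c *\<^sub>R x) = \<bar>c\<bar> * p x)"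

lemma seminorm_onD:
  assumes "seminorm_on W p"
  shows seminorm_on_subspace: "subspace W"
    and seminorm_on_add: "x \<in> W \<Longrightarrow> y \<in> W \<Longrightarrow> p (x + y) \<le> p x + p y"
    and seminorm_on_scaleR: "x \<in> W \<Longrightarrow> p (c *\<^sub>R x) = \<bar>c\<bar> * p x"
  using assms by (auto simp: seminorm_on_def)

lemma seminorm_on_minus: "seminorm_on W p \<Longrightarrow> x \<in> W \<Longrightarrow> p (- x) = p x"
  using seminorm_on_scaleR[of W p x "-1"] by simp

lemma seminorm_on_diff:
  assumes "seminorm_on W p" "x \<in> W" "y \<in> W"
  shows "p (x - y) \<le> p x + p y"
  using seminorm_on_add[OF assms(1,2), of "- y"] seminorm_on_minus[OF assms(1,3)] assms(3)
    subspace_neg[OF seminorm_on_subspace[OF assms(1)]]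
  by simp

lemma seminorm_on_nonneg:
  assumes "seminorm_on W p" "x \<in> W"
  shows "0 \<le> p x"
  using seminorm_on_diff[OF assms assms(2)] seminorm_on_scaleR[OF assms, of 0] by simp

lemma seminorm_on_plus:
  assumes p: "seminorm_on W p" and q: "seminorm_on W q"
  shows "seminorm_on W (\<lambda>x. p x + q x)"
  unfolding seminorm_on_def
proof (intro conjI ballI allI)
  fix x y assume "x \<in> W" "y \<in> W"
  then show "p (x + y) + q (x + y) \<le> p x + q x + (p y + q y)"
    using seminorm_on_add[OF p, of x y] seminorm_on_add[OF q, of x y] by simp
qed (use p q in \<open>simp_all add: seminorm_on_subspace seminorm_on_scaleR distrib_left\<close>)

lemma seminorm_on_cmult:
  assumes "0 \<le> c" and p: "seminorm_on W p"
  shows "seminorm_on W (\<lambda>x. c * p x)"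
  unfolding seminorm_on_def
proof (intro conjI ballI allI)
  fix x y assume "x \<in> W" "y \<in> W"
  then show "c * p (x + y) \<le> c * p x + c * p y"
    using mult_left_mono[OF seminorm_on_add[OF p, of x y] assms(1)] by (simp add: distrib_left)
qed (use p in \<open>simp_all add: seminorm_on_subspace seminorm_on_scaleR\<close>)

lemma seminorm_on_sqrt_sum_squares:
  assumes p: "seminorm_on W p" and q: "seminorm_on W q"
  shows "seminorm_on W (\<lambda>x. sqrt ((p x)\<^sup>2 + (q x)\<^sup>2))"
  unfolding seminorm_on_def
proof (intro conjI ballI allI)
  show "subspace W" using p by (rule seminorm_on_subspace)
next
  fix x y assume xy: "x \<in> W" "y \<in> W"
  have W: "x + y \<in> W" using xy seminorm_on_subspace[OF p] by (simp add: subspace_add)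
  have "sqrt ((p (x + y))\<^sup>2 + (q (x + y))\<^sup>2) \<le> sqrt ((p x + p y)\<^sup>2 + (q x + q y)\<^sup>2)"
    using seminorm_on_add[OF p xy] seminorm_on_add[OF q xy]
      seminorm_on_nonneg[OF p W] seminorm_on_nonneg[OF q W]
    by (intro real_sqrt_le_mono add_mono power_mono)
  also have "\<dots> \<le> sqrt ((p x)\<^sup>2 + (q x)\<^sup>2) + sqrt ((p y)\<^sup>2 + (q y)\<^sup>2)"
    by (rule real_sqrt_sum_squares_triangle_ineq)
  finally show "sqrt ((p (x + y))\<^sup>2 + (q (x + y))\<^sup>2) \<le>
      sqrt ((p x)\<^sup>2 + (q x)\<^sup>2) + sqrt ((p y)\<^sup>2 + (q y)\<^sup>2)" .
next
  fix x c assume x: "x \<in> W"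
  have "(p (c *\<^sub>R x))\<^sup>2 + (q (c *\<^sub>R x))\<^sup>2 = c\<^sup>2 * ((p x)\<^sup>2 + (q x)\<^sup>2)"
    using seminorm_on_scaleR[OF p x] seminorm_on_scaleR[OF q x]
    by (simp add: power_mult_distrib distrib_left)
  then show "sqrt ((p (c *\<^sub>R x))\<^sup>2 + (q (c *\<^sub>R x))\<^sup>2) = \<bar>c\<bar> * sqrt ((p x)\<^sup>2 + (q x)\<^sup>2)"
    by (simp add: real_sqrt_mult)
qed

text \<open>The triangle inequality is Cauchy-Schwarz for a form that may be only semidefinite.
  Vectors with \<open>b y y = 0\<close> are settled by \<open>null\<close>; for the others the
  square of a suitable combination is expanded.\<close>

lemma seminorm_on_sqrt_form:
  fixes b :: "'v::real_vector \<Rightarrow> 'v \<Rightarrow> real"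
  assumes W: "subspace W" and lin: "\<And>x. x \<in> W \<Longrightarrow> lin_on W (b x)"
    and sym: "\<And>x y. x \<in> W \<Longrightarrow> y \<in> W \<Longrightarrow> b x y = b y x"
    and pos: "\<And>x. x \<in> W \<Longrightarrow> 0 \<le> b x x"
  shows "seminorm_on W (\<lambda>x. sqrt (b x x))"
proof -
  have expand: "b (c *\<^sub>R x + d *\<^sub>R y) (c *\<^sub>R x + d *\<^sub>R y)
      = c\<^sup>2 * b x x + 2 * c * d * b x y + d\<^sup>2 * b y y" if xy: "x \<in> W" "y \<in> W" for x y c d
  proof -
    have lin': "b z (c *\<^sub>R x + d *\<^sub>R y) = c * b z x + d * b z y" if "z \<in> W" for z
      using lin[OF that] xy unfolding lin_on_def by simp
    have "c *\<^sub>R x + d *\<^sub>R y \<in> W" using W xy by (simp add: subspace_add subspace_scale)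
    then show ?thesis
      using lin'[of x] lin'[of y] lin'[of "c *\<^sub>R x + d *\<^sub>R y"] sym xy
      by (simp add: power2_eq_square algebra_simps)
  qed
  have pos': "0 \<le> c\<^sup>2 * b x x + 2 * c * d * b x y + d\<^sup>2 * b y y" if "x \<in> W" "y \<in> W" for x y c d
    using expand[OF that, of c d] pos[of "c *\<^sub>R x + d *\<^sub>R y"] W that
    by (simp add: subspace_add subspace_scale)
  have null: "b x y = 0" if xy: "x \<in> W" "y \<in> W" and "b y y = 0" for x y
  proof (rule ccontr)
    assume "b x y \<noteq> 0"
    \<comment> \<open>With \<open>b y y = 0\<close> the quadratic expression is affine in its second
      coefficient; the chosen value makes it equal to -1.\<close>
    then show False
      using pos'[OF xy, of 1 "- (b x x + 1) / (2 * b x y)"] that(3) by (simp add: field_simps)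
  qed
  have schwarz: "b x y \<le> sqrt (b x x) * sqrt (b y y)" if xy: "x \<in> W" "y \<in> W" for x y
  proof (cases "b x x = 0 \<or> b y y = 0")
    case True
    then show ?thesis using null[OF xy] null[OF xy(2,1)] sym[OF xy] pos xy by auto
  next
    case False
    define s t where "s = sqrt (b x x)" and "t = sqrt (b y y)"
    have st: "0 < s" "0 < t" "b x x = s\<^sup>2" "b y y = t\<^sup>2"
      using False pos xy by (simp_all add: s_def t_def less_le)
    \<comment> \<open>The form is evaluated at \<open>t *\<^sub>R x - s *\<^sub>R y\<close>, where
      both squares equal \<open>(s * t)\<^sup>2\<close>.\<close>
    have "0 \<le> 2 * (s * t) * (s * t - b x y)"
      using pos'[OF xy, of t "- s"] st by (simp add: power2_eq_square algebra_simps)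
    then have "b x y \<le> s * t" using mult_pos_pos[OF st(1,2)] by (simp add: zero_le_mult_iff)
    then show ?thesis by (simp add: s_def t_def)
  qed
  show ?thesis
    unfolding seminorm_on_def
  proof (intro conjI ballI allI W)
    fix x y assume xy: "x \<in> W" "y \<in> W"
    show "sqrt (b (x + y) (x + y)) \<le> sqrt (b x x) + sqrt (b y y)"
    proof (rule real_le_lsqrt)
      show "b (x + y) (x + y) \<le> (sqrt (b x x) + sqrt (b y y))\<^sup>2"
        using expand[OF xy, of 1 1] schwarz[OF xy] pos xy by (simp add: power2_sum)
    qed (use pos xy in simp)
  next
    fix x c assume x: "x \<in> W"
    show "sqrt (b (c *\<^sub>R x) (c *\<^sub>R x)) = \<bar>c\<bar> * sqrt (b x x)"
      using expand[OF x x, of c 0] by (simp add: real_sqrt_mult)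
  qed
qed

lemma seminorm_on_linear_vimage:
  assumes p: "seminorm_on W p" and W': "subspace W'" and T: "T ` W' \<subseteq> W" "lin_on W' T"
  shows "seminorm_on W' (\<lambda>x. p (T x))"
  unfolding seminorm_on_def
proof (intro conjI ballI allI W')
  fix x y assume "x \<in> W'" "y \<in> W'"
  moreover from this have "T (x + y) = T x + T y"
    using T(2) unfolding lin_on_def by (metis scaleR_one)
  ultimately show "p (T (x + y)) \<le> p (T x) + p (T y)"
    using T(1) seminorm_on_add[OF p, of "T x" "T y"] by auto
next
  fix x c assume x: "x \<in> W'"
  then have "T (c *\<^sub>R x + 0 *\<^sub>R x) = c *\<^sub>R T x + 0 *\<^sub>R T x"
    using T(2) unfolding lin_on_def by blast
  then show "p (T (c *\<^sub>R x)) = \<bar>c\<bar> * p (T x)"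
    using x T(1) seminorm_on_scaleR[OF p, of "T x" c] by auto
qed

text \<open>Along the line the seminorm is Lipschitz with constant \<open>p a\<close>. If
  \<open>p a = 0\<close> it is constant; otherwise it grows at infinity and the minimum over a
  compact interval is global.\<close>

lemma seminorm_on_line_attains_min:
  assumes p: "seminorm_on W p" and a: "a \<in> W" and b: "b \<in> W"
  shows "\<exists>t. \<forall>t'. p (b - t *\<^sub>R a) \<le> p (b - t' *\<^sub>R a)"
proof -
  have W: "b - t *\<^sub>R a \<in> W" "t *\<^sub>R a \<in> W" for t
    using a b seminorm_on_subspace[OF p] by (simp_all add: subspace_diff subspace_scale)
  define f where "f t = p (b - t *\<^sub>R a)" for t
  have lip: "f t \<le> f s + \<bar>s - t\<bar> * p a" for s t
  proof -
    have "b - t *\<^sub>R a = (b - s *\<^sub>R a) + (s - t) *\<^sub>R a" by (simp add: algebra_simps)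
    then show ?thesis
      unfolding f_def using seminorm_on_add[OF p W(1) W(2)] seminorm_on_scaleR[OF p a] by metis
  qed
  show ?thesis
  proof (cases "p a = 0")
    case True
    then show ?thesis using lip unfolding f_def by auto
  next
    case False
    then have pa: "0 < p a" using seminorm_on_nonneg[OF p a] by simp
    have pb: "0 \<le> p b" using seminorm_on_nonneg[OF p b] .
    \<comment> \<open>Beyond this radius \<bar>t'\<bar> * p a exceeds 2 * p b but is at most p b + f
      t', so f t' lies above p b, which is f 0.\<close>
    define R where "R = 2 * p b / p a"
    have R: "0 \<le> R" using pa pb by (simp add: R_def)
    have "(p a)-lipschitz_on {-R..R} f"
    proof (rule lipschitz_onI)
      fix s t show "dist (f s) (f t) \<le> p a * dist s t"
        using lip[of s t] lip[of t s] by (simp add: dist_real_def abs_minus_commute mult.commute abs_le_iff)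
    qed (use pa in simp)
    then have "continuous_on {-R..R} f" by (rule lipschitz_on_continuous_on)
    then obtain t where t: "t \<in> {-R..R}" "\<forall>t'\<in>{-R..R}. f t \<le> f t'"
      using continuous_attains_inf[of "{-R..R}" f] R by auto
    have "f t \<le> f t'" for t'
    proof (cases "t' \<in> {-R..R}")
      case False
      then have "R < \<bar>t'\<bar>" by auto
      then have "2 * p b < \<bar>t'\<bar> * p a" using pa by (simp add: R_def field_simps)
      moreover have "\<bar>t'\<bar> * p a \<le> p b + f t'"
        using seminorm_on_diff[OF p b W(1)[of t']] seminorm_on_scaleR[OF p a, of t']
        by (simp add: f_def)
      moreover have "f t \<le> f 0" using t R by auto
      ultimately show ?thesis by (simp add: f_def)
    qed (use t in auto)
    then show ?thesis unfolding f_def by auto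
  qed
qed

text \<open>Induction on the spanning vectors with the seminorm kept arbitrary: minimising out the
  direction \<open>a\<close> leaves a new seminorm, to which the hypothesis for \<open>S\<close>
  applies. A minimiser for it becomes one for \<open>p\<close> after adding the optimal multiple of
  \<open>a\<close>.\<close>

lemma seminorm_on_span_attains_min:
  assumes "finite S" "seminorm_on W p" "S \<subseteq> W" "b \<in> W"
  shows "\<exists>s\<in>span S. \<forall>s'\<in>span S. p (b - s) \<le> p (b - s')"
  using assms
proof (induction S arbitrary: p rule: finite_induct)
  case empty
  then show ?case by simp
next
  case (insert a S)
  note p = insert.prems(1)
  have a: "a \<in> W" and S: "S \<subseteq> W" using insert.prems by auto
  note sub = seminorm_on_subspace[OF p]
  obtain \<tau> where \<tau>: "p (x - \<tau> x *\<^sub>R a) \<le> p (x - t *\<^sub>R a)" if "x \<in> W" for x t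
    using seminorm_on_line_attains_min[OF p a] by metis
  \<comment> \<open>the seminorm that \<open>p\<close> induces on the quotient by the line through \<open>a\<close>\<close>
  define p' where "p' x = p (x - \<tau> x *\<^sub>R a)" for x
  have W: "x - t *\<^sub>R a \<in> W" if "x \<in> W" for x t
    using that a sub by (simp add: subspace_diff subspace_scale)
  \<comment> \<open>The minimiser \<open>\<tau>\<close> is merely chosen and need not be
    homogeneous, so \<open>c * \<tau> x\<close> serves as a trial coefficient and gives one
    inequality. The other one follows by rescaling with \<open>1 / c\<close>.\<close>
  have le: "p' (c *\<^sub>R x) \<le> \<bar>c\<bar> * p' x" if "x \<in> W" for c x
  proof -
    have "p' (c *\<^sub>R x) \<le> p (c *\<^sub>R x - (c * \<tau> x) *\<^sub>R a)"
      unfolding p'_def using that sub by (intro \<tau>) (simp add: subspace_scale)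
    also have "c *\<^sub>R x - (c * \<tau> x) *\<^sub>R a = c *\<^sub>R (x - \<tau> x *\<^sub>R a)" by (simp add: algebra_simps)
    finally show ?thesis using seminorm_on_scaleR[OF p W[OF that]] by (simp add: p'_def)
  qed
  have "seminorm_on W p'"
    unfolding seminorm_on_def
  proof (intro conjI ballI allI sub)
    fix x y assume xy: "x \<in> W" "y \<in> W"
    have "p' (x + y) \<le> p ((x + y) - (\<tau> x + \<tau> y) *\<^sub>R a)"
      unfolding p'_def using xy sub by (intro \<tau>) (simp add: subspace_add)
    also have "(x + y) - (\<tau> x + \<tau> y) *\<^sub>R a = (x - \<tau> x *\<^sub>R a) + (y - \<tau> y *\<^sub>R a)"
      by (simp add: algebra_simps)
    also have "p \<dots> \<le> p' x + p' y"
      unfolding p'_def by (intro seminorm_on_add[OF p] W xy)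
    finally show "p' (x + y) \<le> p' x + p' y" .
  next
    fix x c assume x: "x \<in> W"
    have pos: "0 \<le> p' y" if "y \<in> W" for y
      unfolding p'_def using seminorm_on_nonneg[OF p W[OF that]] .
    show "p' (c *\<^sub>R x) = \<bar>c\<bar> * p' x"
    proof (cases "c = 0")
      case True
      then show ?thesis using le[OF x, of 0] pos[of 0] sub by (simp add: subspace_0)
    next
      case False
      have "p' x \<le> \<bar>1 / c\<bar> * p' (c *\<^sub>R x)"
        using le[of "c *\<^sub>R x" "1 / c"] False x sub by (simp add: subspace_scale)
      then have "\<bar>c\<bar> * p' x \<le> p' (c *\<^sub>R x)" using False by (simp add: field_simps)
      with le[OF x, of c] show ?thesis by simp
    qed
  qed
  from insert.IH[OF this S insert.prems(3)] obtain s where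
    s: "s \<in> span S" "\<And>s'. s' \<in> span S \<Longrightarrow> p' (b - s) \<le> p' (b - s')" by blast
  have spanW: "span S \<subseteq> W" using S sub by (rule span_minimal)
  \<comment> \<open>The coefficient is the optimal one for \<open>b - s\<close>, so that
    \<open>p (b - ?s)\<close> is exactly \<open>p' (b - s)\<close>.\<close>
  let ?s = "s + \<tau> (b - s) *\<^sub>R a"
  show ?case
  proof (intro bexI ballI)
    show "?s \<in> span (insert a S)"
      using s(1) unfolding span_insert by (auto intro: exI[of _ "\<tau> (b - s)"])
    fix s' assume "s' \<in> span (insert a S)"
    then obtain k where k: "s' - k *\<^sub>R a \<in> span S" unfolding span_insert by auto
    then have "b - (s' - k *\<^sub>R a) \<in> W"
      using insert.prems(3) spanW sub by (intro subspace_diff[of W b]) auto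
    then have "p' (b - (s' - k *\<^sub>R a)) \<le> p (b - (s' - k *\<^sub>R a) - k *\<^sub>R a)"
      unfolding p'_def by (rule \<tau>)
    with s(2)[OF k] show "p (b - ?s) \<le> p (b - s')" by (simp add: p'_def algebra_simps)
  qed
qed

text \<open>An affine function of \<open>z\<close> is the restriction to \<open>t = 1\<close> of a linear function of \<open>(z, t)\<close>.\<close>

lemma seminorm_on_affine_attains_min:
  assumes p: "seminorm_on (W \<times> UNIV) (\<lambda>(z, t). p z t)"
    and X: "finite_dim_subspace X" "X \<subseteq> W"
  shows "\<exists>z\<in>X. \<forall>z'\<in>X. p z (1::real) \<le> p z' 1"
proof -
  obtain S where S: "finite S" "X = span S" using X(1) unfolding finite_dim_subspace_def by blast
  have "linear (\<lambda>s. (s, 0::real))" by (rule linearI) auto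
  then have span: "span ((\<lambda>s. (s, 0::real)) ` S) = (\<lambda>s. (s, 0)) ` X"
    unfolding S(2) by (rule linear_span_image)
  have neg: "- z \<in> X" if "z \<in> X" for z using that by (simp add: S span_neg)
  have "(0, 1) \<in> W \<times> UNIV" using X(2) span_zero[of S] S(2) by auto
  moreover have "(\<lambda>s. (s, 0)) ` S \<subseteq> W \<times> UNIV" using X(2) S(2) span_superset by auto
  \<comment> \<open>Minimising over \<open>X\<close> becomes the distance problem from the point
    \<open>(0, 1)\<close> to the subspace of pairs \<open>(s, 0)\<close>; the differences are
    \<open>(- s, 1)\<close>, which explains the signs.\<close>
  ultimately obtain s where s: "s \<in> X" "\<And>s'. s' \<in> X \<Longrightarrow> p (- s) 1 \<le> p (- s') 1"
    using seminorm_on_span_attains_min[OF _ p, of "(\<lambda>s. (s, 0)) ` S" "(0, 1)"] S(1) span by force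
  show ?thesis
  proof (intro bexI ballI)
    show "- s \<in> X" using neg s(1) .
    fix z assume "z \<in> X"
    then show "p (- s) 1 \<le> p z 1" using s(2)[of "- z"] neg by simp
  qed
qed

lemma min_over_attained:
  fixes F :: "'v \<Rightarrow> real"
  assumes "z \<in> S" "\<And>z'. z' \<in> S \<Longrightarrow> F z \<le> F z'"
  shows "min_over S F = F z"
  unfolding min_over_def using assms by (intro Least_equality) auto

section \<open>Dual norms\<close>

text \<open>Boundedness is separated from linearity because it is what keeps the real-valued
  supremum in \<open>dual_norm\<close> meaningful, and it passes directly to sums and to composition
  with \<open>E\<close>.\<close>

definition bounded_functional :: "'v set \<Rightarrow> ('v \<Rightarrow> real) \<Rightarrow> ('v \<Rightarrow> real) \<Rightarrow> bool" where
  "bounded_functional V nV f \<longleftrightarrow> (\<exists>K. \<forall>v\<in>V. \<bar>f v\<bar> \<le> K * nV v)"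

lemma dual_bounded: "f \<in> dual V nV \<Longrightarrow> bounded_functional V nV f"
  by (simp add: dual_def bounded_functional_def)

lemma bounded_functional_nonneg_bound:
  assumes "\<And>v. v \<in> V \<Longrightarrow> 0 \<le> nV v" "bounded_functional V nV f"
  obtains K where "0 \<le> K" "\<And>v. v \<in> V \<Longrightarrow> \<bar>f v\<bar> \<le> K * nV v"
proof -
  obtain K where K: "\<And>v. v \<in> V \<Longrightarrow> \<bar>f v\<bar> \<le> K * nV v"
    using assms(2) unfolding bounded_functional_def by blast
  show ?thesis
  proof (rule that[of "max K 0"])
    fix v assume v: "v \<in> V"
    have "K * nV v \<le> max K 0 * nV v" using assms(1)[OF v] by (intro mult_right_mono) auto
    with K[OF v] show "\<bar>f v\<bar> \<le> max K 0 * nV v" by linarith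
  qed simp
qed

lemma bounded_functional_lin_comb:
  assumes nV: "\<And>v. v \<in> V \<Longrightarrow> 0 \<le> nV v" and "bounded_functional V nV f" "bounded_functional V nV g"
  shows "bounded_functional V nV (\<lambda>v. a * f v + b * g v)"
proof -
  obtain K where K: "0 \<le> K" "\<And>v. v \<in> V \<Longrightarrow> \<bar>f v\<bar> \<le> K * nV v"
    using bounded_functional_nonneg_bound[OF nV assms(2)] by blast
  obtain L where L: "0 \<le> L" "\<And>v. v \<in> V \<Longrightarrow> \<bar>g v\<bar> \<le> L * nV v"
    using bounded_functional_nonneg_bound[OF nV assms(3)] by blast
  have "\<bar>a * f v + b * g v\<bar> \<le> (\<bar>a\<bar> * K + \<bar>b\<bar> * L) * nV v" if "v \<in> V" for v
  proof -
    have "\<bar>a * f v + b * g v\<bar> \<le> \<bar>a\<bar> * \<bar>f v\<bar> + \<bar>b\<bar> * \<bar>g v\<bar>"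
      by (metis abs_mult abs_triangle_ineq)
    also have "\<dots> \<le> \<bar>a\<bar> * (K * nV v) + \<bar>b\<bar> * (L * nV v)"
      using K(2)[OF that] L(2)[OF that] by (intro add_mono mult_left_mono) auto
    finally show ?thesis by (simp add: algebra_simps)
  qed
  then show ?thesis unfolding bounded_functional_def by blast
qed

lemma
  assumes "\<And>v. v \<in> V \<Longrightarrow> 0 \<le> nV v" "bounded_functional V nV f" "bounded_functional V nV g"
  shows bounded_functional_add: "bounded_functional V nV (\<lambda>v. f v + g v)"
    and bounded_functional_diff: "bounded_functional V nV (\<lambda>v. f v - g v)"
  using bounded_functional_lin_comb[OF assms, of 1 1] bounded_functional_lin_comb[OF assms, of 1 "-1"]
  by simp_all

text \<open>For b = 0 the quotient is 0 by convention and 0 \<le> M covers it; in this way vectors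
  of norm zero enter the suprema harmlessly.\<close>

lemma divide_le_of_le_mult:
  fixes a b M :: real
  assumes "0 \<le> M" "0 \<le> b" "a \<le> M * b"
  shows "a / b \<le> M"
  using assms by (cases "b = 0") (auto simp: divide_le_eq)

lemma dual_norm_le:
  assumes nV: "\<And>v. v \<in> V \<Longrightarrow> 0 \<le> nV v" and "V \<noteq> {}" "0 \<le> M"
    and "\<And>v. v \<in> V \<Longrightarrow> \<bar>f v\<bar> \<le> M * nV v"
  shows "dual_norm V nV f \<le> M"
  unfolding dual_norm_def using assms by (intro cSUP_least divide_le_of_le_mult) auto

text \<open>Common core of the estimates for \<open>dual_norm\<close> and \<open>op_norm\<close>.
  Where \<open>b v\<close> vanishes the ratio carries no information, and the bound with
  \<open>K\<close> forces \<open>a v\<close> to be at most 0. Elsewhere that bound makes the set of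
  ratios bounded above.\<close>

lemma le_SUP_ratio:
  fixes a b :: "'v \<Rightarrow> real"
  assumes b: "\<And>v. v \<in> V \<Longrightarrow> 0 \<le> b v" and K: "\<And>v. v \<in> V \<Longrightarrow> a v \<le> K * b v" and v: "v \<in> V"
  shows "a v \<le> (SUP v\<in>V. a v / b v) * b v"
proof (cases "b v = 0")
  case True
  then show ?thesis using K[OF v] by simp
next
  case False
  have "a w / b w \<le> max K 0" if "w \<in> V" for w
  proof (rule divide_le_of_le_mult)
    show "a w \<le> max K 0 * b w"
      using K[OF that] mult_right_mono[OF max.cobounded1[of K 0] b[OF that]] by linarith
  qed (use b[OF that] in auto)
  then have "bdd_above ((\<lambda>v. a v / b v) ` V)" by (auto simp: bdd_above_def)
  then have "a v / b v \<le> (SUP v\<in>V. a v / b v)" using v by (rule cSUP_upper2) auto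
  moreover have "0 < b v" using False b[OF v] by simp
  ultimately show ?thesis by (simp add: divide_le_eq)
qed

lemma abs_le_dual_norm:
  assumes "\<And>v. v \<in> V \<Longrightarrow> 0 \<le> nV v" "bounded_functional V nV f" "v \<in> V"
  shows "\<bar>f v\<bar> \<le> dual_norm V nV f * nV v"
proof -
  obtain K where "\<And>v. v \<in> V \<Longrightarrow> \<bar>f v\<bar> \<le> K * nV v"
    using assms(2) unfolding bounded_functional_def by blast
  then show ?thesis unfolding dual_norm_def using le_SUP_ratio[of V nV "\<lambda>v. \<bar>f v\<bar>" K v] assms by blast
qed

lemma dual_norm_nonneg:
  assumes "\<And>v. v \<in> V \<Longrightarrow> 0 \<le> nV v" "bounded_functional V nV f" "V \<noteq> {}"
  shows "0 \<le> dual_norm V nV f"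
proof -
  obtain v where v: "v \<in> V" using assms(3) by blast
  obtain K where K: "0 \<le> K" "\<And>v. v \<in> V \<Longrightarrow> \<bar>f v\<bar> \<le> K * nV v"
    using bounded_functional_nonneg_bound[OF assms(1,2)] by blast
  have "bdd_above ((\<lambda>v. \<bar>f v\<bar> / nV v) ` V)"
    using K assms(1) by (auto simp: bdd_above_def intro!: exI[of _ K] divide_le_of_le_mult)
  then have "\<bar>f v\<bar> / nV v \<le> dual_norm V nV f" unfolding dual_norm_def using v by (rule cSUP_upper2) auto
  moreover have "0 \<le> \<bar>f v\<bar> / nV v" using assms(1)[OF v] by simp
  ultimately show ?thesis by linarith
qed

lemma dual_norm_cong: "(\<And>v. v \<in> V \<Longrightarrow> \<bar>f v\<bar> = \<bar>g v\<bar>) \<Longrightarrow> dual_norm V nV f = dual_norm V nV g"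
  unfolding dual_norm_def by (intro arg_cong[where f=Sup] image_cong) auto

lemma dual_norm_scaleR_le:
  assumes nV: "\<And>v. v \<in> V \<Longrightarrow> 0 \<le> nV v" and f: "bounded_functional V nV f" and "V \<noteq> {}"
  shows "dual_norm V nV (\<lambda>v. c * f v) \<le> \<bar>c\<bar> * dual_norm V nV f"
proof (rule dual_norm_le[OF nV \<open>V \<noteq> {}\<close>])
  show "0 \<le> \<bar>c\<bar> * dual_norm V nV f" using dual_norm_nonneg[OF assms] by simp
  fix v assume "v \<in> V"
  then show "\<bar>c * f v\<bar> \<le> \<bar>c\<bar> * dual_norm V nV f * nV v"
    using abs_le_dual_norm[OF nV f] by (simp add: abs_mult mult.assoc mult_left_mono)
qed

lemma dual_norm_triangle:
  assumes nV: "\<And>v. v \<in> V \<Longrightarrow> 0 \<le> nV v" and f: "bounded_functional V nV f" and g: "bounded_functional V nV g"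
    and "V \<noteq> {}"
  shows "dual_norm V nV (\<lambda>v. f v + g v) \<le> dual_norm V nV f + dual_norm V nV g"
proof (rule dual_norm_le[OF nV \<open>V \<noteq> {}\<close>])
  show "0 \<le> dual_norm V nV f + dual_norm V nV g"
    using dual_norm_nonneg[OF nV f] dual_norm_nonneg[OF nV g] \<open>V \<noteq> {}\<close> by simp
  fix v assume v: "v \<in> V"
  show "\<bar>f v + g v\<bar> \<le> (dual_norm V nV f + dual_norm V nV g) * nV v"
    using abs_le_dual_norm[OF nV f v] abs_le_dual_norm[OF nV g v] by (simp add: distrib_right)
qed

text \<open>Viewed as a supremum of the seminorms \<bar>T x v\<bar> / nV v, finite by
  \<open>bdd\<close>. This is what turns a functional depending linearly on a trial function into a
  seminorm of that trial function.\<close>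

lemma seminorm_on_dual_norm:
  assumes nV: "\<And>v. v \<in> V \<Longrightarrow> 0 \<le> nV v" and V: "V \<noteq> {}" and W: "subspace W"
    and bdd: "\<And>x. x \<in> W \<Longrightarrow> bounded_functional V nV (T x)"
    and lin: "\<And>v. v \<in> V \<Longrightarrow> lin_on W (\<lambda>x. T x v)"
  shows "seminorm_on W (\<lambda>x. dual_norm V nV (T x))"
  unfolding seminorm_on_def
proof (intro conjI ballI allI W)
  fix x y assume xy: "x \<in> W" "y \<in> W"
  have "T (1 *\<^sub>R x + 1 *\<^sub>R y) v = 1 *\<^sub>R T x v + 1 *\<^sub>R T y v" if "v \<in> V" for v
    using lin[OF that] xy unfolding lin_on_def by blast
  then have "dual_norm V nV (T (x + y)) = dual_norm V nV (\<lambda>v. T x v + T y v)"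
    by (intro dual_norm_cong) simp
  then show "dual_norm V nV (T (x + y)) \<le> dual_norm V nV (T x) + dual_norm V nV (T y)"
    using dual_norm_triangle[OF nV bdd bdd V] xy by simp
next
  fix x c assume x: "x \<in> W"
  have scale: "T (c *\<^sub>R x) v = c * T x v" if "v \<in> V" "x \<in> W" for c x v
  proof -
    have "T (c *\<^sub>R x + 0 *\<^sub>R x) v = c *\<^sub>R T x v + 0 *\<^sub>R T x v"
      using lin[OF that(1)] that(2) unfolding lin_on_def by blast
    then show ?thesis by simp
  qed
  have le: "dual_norm V nV (T (c *\<^sub>R x)) \<le> \<bar>c\<bar> * dual_norm V nV (T x)" if "x \<in> W" for c x
  proof -
    have "dual_norm V nV (T (c *\<^sub>R x)) = dual_norm V nV (\<lambda>v. c * T x v)"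
      using scale that by (intro dual_norm_cong) simp
    with dual_norm_scaleR_le[OF nV bdd[OF that] V] show ?thesis by simp
  qed
  show "dual_norm V nV (T (c *\<^sub>R x)) = \<bar>c\<bar> * dual_norm V nV (T x)"
  proof (cases "c = 0")
    case True
    then show ?thesis
      using le[OF x, of 0] dual_norm_nonneg[OF nV bdd V, of 0] subspace_0[OF W] by simp
  next
    case False
    \<comment> \<open>Scaling gives only an upper bound; applied to \<open>c *\<^sub>R x\<close>
      with the factor \<open>1 / c\<close> it becomes the lower bound.\<close>
    have "dual_norm V nV (T x) \<le> \<bar>1 / c\<bar> * dual_norm V nV (T (c *\<^sub>R x))"
      using le[of "c *\<^sub>R x" "1 / c"] False x W by (simp add: subspace_scale)
    then have "\<bar>c\<bar> * dual_norm V nV (T x) \<le> dual_norm V nV (T (c *\<^sub>R x))"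
      using False by (simp add: field_simps)
    with le[OF x, of c] show ?thesis by simp
  qed
qed

lemma op_norm_bound:
  assumes nV: "\<And>v. v \<in> V \<Longrightarrow> 0 \<le> nV v" and T: "T \<in> bounded_ops V nV W nW" and v: "v \<in> V"
  shows "nW (T v) \<le> op_norm V nV nW T * nV v"
  using le_SUP_ratio[of V nV "\<lambda>v. nW (T v)"] assms unfolding op_norm_def bounded_ops_def by blast

section \<open>Square integrable functions\<close>

lemma ae_class_rep: "ae_class (rep_ae f) = f"
  using Quotient_aefun by (rule Quotient_abs_rep)

lemma ae_class_eq_iff: "ae_class f = ae_class g \<longleftrightarrow> (AE x in lebesgue. f x = g x)"
  using Quotient_rel_abs[OF Quotient_aefun] aefun.abs_eq_iff[of f g] by (simp add: ae_eq_def)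

text \<open>\<open>rep_ae\<close> selects some member of the class, so a given representative is
  recovered only almost everywhere. Identities between representatives are therefore stated in the
  AE sense.\<close>

lemma rep_ae_class: "AE x in lebesgue. rep_ae (ae_class f) x = f x"
  using ae_class_eq_iff[of "rep_ae (ae_class f)" f] by (simp add: ae_class_rep)

lemma rep_ae_lin_comb:
  "AE x in lebesgue. rep_ae (a *\<^sub>R f + b *\<^sub>R g) x = a * rep_ae f x + b * rep_ae g x"
proof -
  have "a *\<^sub>R f + b *\<^sub>R g = ae_class (\<lambda>x. a * rep_ae f x + b * rep_ae g x)"
    by (metis ae_class_rep plus_aefun.abs_eq scaleR_aefun.abs_eq)
  then show ?thesis by (simp add: rep_ae_class)
qed

lemma rep_ae_zero: "AE x in lebesgue. rep_ae 0 x = 0"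
  unfolding zero_aefun_def by (rule rep_ae_class)

text \<open>Membership may be checked on any explicit representative. Measurability passes to
  \<open>rep_ae F\<close> because Lebesgue measure is complete.\<close>

lemma L2_I:
  assumes f: "f \<in> borel_measurable lebesgue" "integrable lebesgue (\<lambda>x. (f x)\<^sup>2)"
    and z: "AE x in lebesgue. x \<notin> \<Omega> \<longrightarrow> f x = 0" and eq: "AE x in lebesgue. rep_ae F x = f x"
  shows "F \<in> L2 \<Omega>"
proof -
  have eq': "AE x in lebesgue. f x = rep_ae F x" using eq by (auto elim: AE_mp)
  have m: "rep_ae F \<in> borel_measurable lebesgue"
    using f(1) eq' by (rule borel_measurable_AE)
  moreover have "integrable lebesgue (\<lambda>x. (rep_ae F x)\<^sup>2)"
  proof (rule iffD1[OF integrable_cong_AE f(2)])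
    show "AE x in lebesgue. (f x)\<^sup>2 = (rep_ae F x)\<^sup>2" using eq' by (auto elim: AE_mp)
  qed (use f(1) m in measurable)
  moreover have "AE x in lebesgue. x \<notin> \<Omega> \<longrightarrow> rep_ae F x = 0"
    using z eq by eventually_elim auto
  ultimately show ?thesis unfolding L2_def functions_on_def by simp
qed

lemma L2_D:
  assumes "f \<in> L2 \<Omega>"
  shows L2_measurable: "rep_ae f \<in> borel_measurable lebesgue"
    and L2_integrable: "integrable lebesgue (\<lambda>x. (rep_ae f x)\<^sup>2)"
    and L2_outside: "AE x in lebesgue. x \<notin> \<Omega> \<longrightarrow> rep_ae f x = 0"
  using assms by (auto simp: L2_def functions_on_def)

text \<open>Extension by zero makes the data \<open>q\<close> an element of
  \<open>L2 \<Omega>\<close>, so that \<open>opC \<omega> z - q\<close> can be handled by the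
  seminorm on that space.\<close>

lemma L2_mono: "\<omega> \<subseteq> \<Omega> \<Longrightarrow> L2 \<omega> \<subseteq> L2 \<Omega>"
  unfolding L2_def functions_on_def by (auto elim: AE_mp)

lemma L2_mult_integrable:
  assumes "f \<in> L2 \<Omega>" "g \<in> L2 \<Omega>"
  shows "integrable lebesgue (\<lambda>x. rep_ae f x * rep_ae g x)"
proof (rule Bochner_Integration.integrable_bound)
  show "integrable lebesgue (\<lambda>x. (rep_ae f x)\<^sup>2 + (rep_ae g x)\<^sup>2)"
    using assms by (intro Bochner_Integration.integrable_add L2_integrable)
  show "(\<lambda>x. rep_ae f x * rep_ae g x) \<in> borel_measurable lebesgue"
    using assms by (intro borel_measurable_times L2_measurable)
  have "\<bar>a * b\<bar> \<le> \<bar>a\<^sup>2 + b\<^sup>2\<bar>" for a b :: real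
  proof -
    have "2 * (\<bar>a\<bar> * \<bar>b\<bar>) \<le> a\<^sup>2 + b\<^sup>2"
      using sum_squares_bound[of "\<bar>a\<bar>" "\<bar>b\<bar>"] by (simp add: mult.assoc)
    moreover have "0 \<le> \<bar>a\<bar> * \<bar>b\<bar>" by simp
    ultimately show ?thesis unfolding abs_mult by linarith
  qed
  then show "AE x in lebesgue. norm (rep_ae f x * rep_ae g x)
      \<le> norm ((rep_ae f x)\<^sup>2 + (rep_ae g x)\<^sup>2)" by simp
qed

lemma subspace_L2: "subspace (L2 \<Omega>)"
proof -
  have lc: "a *\<^sub>R f + b *\<^sub>R g \<in> L2 \<Omega>" if fg: "f \<in> L2 \<Omega>" "g \<in> L2 \<Omega>" for a b f g
  proof (rule L2_I[OF _ _ _ rep_ae_lin_comb])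
    show "(\<lambda>x. a * rep_ae f x + b * rep_ae g x) \<in> borel_measurable lebesgue"
      using L2_measurable[OF fg(1)] L2_measurable[OF fg(2)] by measurable
    have "(\<lambda>x. (a * rep_ae f x + b * rep_ae g x)\<^sup>2) = (\<lambda>x. a\<^sup>2 * (rep_ae f x)\<^sup>2 +
        2 * a * b * (rep_ae f x * rep_ae g x) + b\<^sup>2 * (rep_ae g x)\<^sup>2)"
      by (simp add: fun_eq_iff power2_eq_square algebra_simps)
    then show "integrable lebesgue (\<lambda>x. (a * rep_ae f x + b * rep_ae g x)\<^sup>2)"
      using L2_integrable[OF fg(1)] L2_integrable[OF fg(2)] L2_mult_integrable[OF fg] by simp
    show "AE x in lebesgue. x \<notin> \<Omega> \<longrightarrow> a * rep_ae f x + b * rep_ae g x = 0"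
      using L2_outside[OF fg(1)] L2_outside[OF fg(2)] by eventually_elim auto
  qed
  show ?thesis
    unfolding subspace_def
  proof (intro conjI ballI allI)
    show "0 \<in> L2 \<Omega>" by (rule L2_I[OF _ _ _ rep_ae_zero]) auto
  next
    fix f g assume "f \<in> L2 \<Omega>" "g \<in> L2 \<Omega>"
    then show "f + g \<in> L2 \<Omega>" using lc[of f g 1 1] by simp
  next
    fix f c assume "f \<in> L2 \<Omega>"
    then show "c *\<^sub>R f \<in> L2 \<Omega>" using lc[of f f c 0] by simp
  qed
qed

lemma seminorm_on_L2_nrm: "seminorm_on (L2 \<Omega>) L2_nrm"
proof -
  let ?b = "\<lambda>f g. LINT x|lebesgue. rep_ae f x * rep_ae g x"
  have "seminorm_on (L2 \<Omega>) (\<lambda>f. sqrt (?b f f))"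
  proof (rule seminorm_on_sqrt_form[of _ ?b, OF subspace_L2])
    fix f assume f: "f \<in> L2 \<Omega>"
    show "lin_on (L2 \<Omega>) (?b f)"
      unfolding lin_on_def
    proof (intro ballI allI)
      fix g h a b assume g: "g \<in> L2 \<Omega>" and h: "h \<in> L2 \<Omega>"
      have gh: "a *\<^sub>R g + b *\<^sub>R h \<in> L2 \<Omega>"
        using g h subspace_L2[of \<Omega>] by (simp add: subspace_add subspace_scale)
      have "?b f (a *\<^sub>R g + b *\<^sub>R h)
          = (LINT x|lebesgue. a * (rep_ae f x * rep_ae g x) + b * (rep_ae f x * rep_ae h x))"
      proof (rule integral_cong_AE)
        show "AE x in lebesgue. rep_ae f x * rep_ae (a *\<^sub>R g + b *\<^sub>R h) x
            = a * (rep_ae f x * rep_ae g x) + b * (rep_ae f x * rep_ae h x)"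
          using rep_ae_lin_comb[of a g b h] by eventually_elim (simp add: algebra_simps)
      qed (use L2_measurable[OF f] L2_measurable[OF g] L2_measurable[OF h] L2_measurable[OF gh]
          in measurable)
      then show "?b f (a *\<^sub>R g + b *\<^sub>R h) = a *\<^sub>R ?b f g + b *\<^sub>R ?b f h"
        using L2_mult_integrable[OF f g] L2_mult_integrable[OF f h] by simp
    qed
  qed (simp_all add: mult.commute)
  then show ?thesis by (simp add: L2_nrm_def[abs_def] power2_eq_square)
qed

lemma L2_nrm_nonneg: "0 \<le> L2_nrm f"
  by (simp add: L2_nrm_def)

lemma lin_on_opC: "lin_on V (opC \<omega>)"
  unfolding lin_on_def
proof (intro ballI allI)
  fix f g a b
  have "AE x in lebesgue. indicator \<omega> x * rep_ae (a *\<^sub>R f + b *\<^sub>R g) x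
      = a * (indicator \<omega> x * rep_ae f x) + b * (indicator \<omega> x * rep_ae g x)"
    using rep_ae_lin_comb[of a f b g] by eventually_elim (simp add: algebra_simps)
  then show "opC \<omega> (a *\<^sub>R f + b *\<^sub>R g) = a *\<^sub>R opC \<omega> f + b *\<^sub>R opC \<omega> g"
    by (simp add: opC_def restrict_ae_def plus_aefun.abs_eq scaleR_aefun.abs_eq ae_class_eq_iff)
qed

lemma
  assumes "\<omega> \<in> sets lebesgue" "f \<in> L2 \<Omega>"
  shows opC_in_L2: "opC \<omega> f \<in> L2 \<Omega>" and L2_nrm_opC_le: "L2_nrm (opC \<omega> f) \<le> L2_nrm f"
proof -
  have eq: "AE x in lebesgue. rep_ae (opC \<omega> f) x = indicator \<omega> x * rep_ae f x"
    unfolding opC_def restrict_ae_def by (rule rep_ae_class)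
  have [measurable]: "\<omega> \<in> sets lebesgue" by fact
  note [measurable] = L2_measurable[OF assms(2)]
  have le: "(indicator \<omega> x * rep_ae f x)\<^sup>2 \<le> (rep_ae f x)\<^sup>2" for x
    by (simp add: indicator_def)
  show mem: "opC \<omega> f \<in> L2 \<Omega>"
  proof (rule L2_I[OF _ _ _ eq])
    show "(\<lambda>x. indicator \<omega> x * rep_ae f x) \<in> borel_measurable lebesgue" by measurable
    show "integrable lebesgue (\<lambda>x. (indicator \<omega> x * rep_ae f x)\<^sup>2)"
      using L2_integrable[OF assms(2)]
      by (rule Bochner_Integration.integrable_bound) (use le in \<open>auto intro!: AE_I2\<close>)
    show "AE x in lebesgue. x \<notin> \<Omega> \<longrightarrow> indicator \<omega> x * rep_ae f x = 0"
      using L2_outside[OF assms(2)] by eventually_elim auto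
  qed
  have "(LINT x|lebesgue. (rep_ae (opC \<omega> f) x)\<^sup>2) \<le> (LINT x|lebesgue. (rep_ae f x)\<^sup>2)"
  proof (rule integral_mono_AE[OF L2_integrable[OF mem] L2_integrable[OF assms(2)]])
    show "AE x in lebesgue. (rep_ae (opC \<omega> f) x)\<^sup>2 \<le> (rep_ae f x)\<^sup>2"
      using eq by eventually_elim (use le in simp)
  qed
  then show "L2_nrm (opC \<omega> f) \<le> L2_nrm f" by (simp add: L2_nrm_def)
qed

section \<open>Nonconforming test spaces\<close>

lemma lin_on_add:
  assumes "lin_on V T" "x \<in> V" "y \<in> V"
  shows "T (x + y) = T x + T y"
proof -
  have "T (1 *\<^sub>R x + 1 *\<^sub>R y) = 1 *\<^sub>R T x + 1 *\<^sub>R T y"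
    using assms unfolding lin_on_def by blast
  then show ?thesis by simp
qed

lemma lin_on_diff:
  assumes "lin_on V T" "x \<in> V" "y \<in> V"
  shows "T (x - y) = T x - T y"
proof -
  have "T (1 *\<^sub>R x + (- 1) *\<^sub>R y) = 1 *\<^sub>R T x + (- 1) *\<^sub>R T y"
    using assms unfolding lin_on_def by blast
  then show ?thesis by simp
qed

lemma lin_on_zero:
  assumes "lin_on V T" "0 \<in> V"
  shows "T 0 = 0"
  using lin_on_diff[OF assms assms(2)] by simp

lemma ip_norm_zero:
  assumes "inner_product_on V ip" "0 \<in> V"
  shows "ip_norm ip 0 = 0"
proof -
  have "lin_on V (ip 0)" using assms by (simp add: inner_product_on_def)
  then show ?thesis using assms(2) lin_on_zero[of V "ip 0"] by (simp add: ip_norm_def)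
qed

lemma ip_norm_nonneg:
  assumes "inner_product_on V ip" "0 \<in> V" "v \<in> V"
  shows "0 \<le> ip_norm ip v"
proof (cases "v = 0")
  case True
  then show ?thesis using ip_norm_zero[OF assms(1,2)] by simp
next
  case False
  then have "0 < ip v v" using assms by (simp add: inner_product_on_def)
  then show ?thesis by (simp add: ip_norm_def)
qed

lemma finite_dim_subspace_zero: "finite_dim_subspace V \<Longrightarrow> 0 \<in> V"
  by (auto simp: finite_dim_subspace_def span_zero)

lemma H2_nrm_nonneg: "0 \<le> H2_nrm \<Omega> v"
  unfolding H2_nrm_def by (intro real_sqrt_ge_zero add_nonneg_nonneg sum_nonneg) auto

lemma data_nrm_ge: "\<bar>Hm2_nrm \<Omega> f\<bar> \<le> data_nrm \<Omega> f g" "\<bar>L2_nrm g\<bar> \<le> data_nrm \<Omega> f g"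
  unfolding data_nrm_def by (rule real_le_rsqrt; simp)+

lemma data_nrm_le: "0 \<le> Hm2_nrm \<Omega> f \<Longrightarrow> data_nrm \<Omega> f g \<le> Hm2_nrm \<Omega> f + L2_nrm g"
  unfolding data_nrm_def by (rule sqrt_sum_squares_le_sum) (simp_all add: L2_nrm_nonneg)

lemma
  assumes V: "\<And>v. v \<in> V \<Longrightarrow> 0 \<le> nV v" and W: "\<And>w. w \<in> W \<Longrightarrow> 0 \<le> nW w"
  shows sum_norm_le: "v \<in> V \<Longrightarrow> w \<in> W \<Longrightarrow> sum_norm V nV W nW (v + w) \<le> nV v + nW w"
    and sum_norm_nonneg: "x \<in> set_sum V W \<Longrightarrow> 0 \<le> sum_norm V nV W nW x"
proof -
  have nn: "0 \<le> r" if "r \<in> {nV v + nW w | v w. v \<in> V \<and> w \<in> W \<and> x = v + w}" for r x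
    using that V W by fastforce
  then have "bdd_below {nV v + nW w | v w. v \<in> V \<and> w \<in> W \<and> x = v + w}" for x
    unfolding bdd_below_def by blast
  then show "v \<in> V \<Longrightarrow> w \<in> W \<Longrightarrow> sum_norm V nV W nW (v + w) \<le> nV v + nW w"
    unfolding sum_norm_def by (intro cInf_lower) auto
  show "x \<in> set_sum V W \<Longrightarrow> 0 \<le> sum_norm V nV W nW x"
    unfolding sum_norm_def set_sum_def by (intro cInf_greatest nn) auto
qed

lemma subspace_Times_UNIV: "subspace V \<Longrightarrow> subspace (V \<times> UNIV)"
  by (rule subspace_Times) simp_all

context nonconforming_tests
begin

section \<open>Bounds for \<open>E\<close>, \<open>Q\<close>, \<open>B\<close> and
  \<open>opB\<close>\<close>

lemma Y_zero: "\<delta> \<in> I \<Longrightarrow> 0 \<in> Y \<delta>"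
  using Y(1) finite_dim_subspace_zero by blast

lemma Y_nrm_nonneg: "\<delta> \<in> I \<Longrightarrow> v \<in> Y \<delta> \<Longrightarrow> 0 \<le> ip_norm (ip \<delta>) v"
  using ip_norm_nonneg[OF Y(3) Y_zero] by blast

lemma E_in_H20: "\<delta> \<in> I \<Longrightarrow> v \<in> Y \<delta> \<Longrightarrow> E \<delta> v \<in> H20 \<Omega>"
  using E unfolding bounded_ops_def by blast

lemma Q_in_Y: "\<delta> \<in> I \<Longrightarrow> v \<in> H20 \<Omega> \<Longrightarrow> Q \<delta> v \<in> Y \<delta>"
  using Q unfolding bounded_ops_def by blast

text \<open>Linearity and boundedness of \<open>E\<close> yield these facts without the uniqueness of weak
  derivatives.\<close>

lemma H20_zero: "\<delta> \<in> I \<Longrightarrow> 0 \<in> H20 \<Omega>" and H2_nrm_zero: "\<delta> \<in> I \<Longrightarrow> H2_nrm \<Omega> 0 = 0"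
proof -
  assume \<delta>: "\<delta> \<in> I"
  have E0: "E \<delta> 0 = 0"
    using E[OF \<delta>] lin_on_zero[OF _ Y_zero[OF \<delta>]] unfolding bounded_ops_def by blast
  then show "0 \<in> H20 \<Omega>" using E_in_H20[OF \<delta> Y_zero[OF \<delta>]] by simp
  obtain K where "H2_nrm \<Omega> (E \<delta> 0) \<le> K * ip_norm (ip \<delta>) 0"
    using E[OF \<delta>] Y_zero[OF \<delta>] unfolding bounded_ops_def by blast
  then show "H2_nrm \<Omega> 0 = 0"
    using E0 ip_norm_zero[OF Y(3) Y_zero] \<delta> H2_nrm_nonneg[of \<Omega> 0] by simp
qed

text \<open>The supremum of the operator norms over the family is spelled out vector by vector.
  Passing to \<open>max M 0\<close> keeps the constant nonnegative for later products.\<close>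

lemma E_bound: "\<exists>CE\<ge>0. \<forall>\<delta>\<in>I. \<forall>v\<in>Y \<delta>. H2_nrm \<Omega> (E \<delta> v) \<le> CE * ip_norm (ip \<delta>) v"
proof -
  obtain M where M: "op_norm (Y \<delta>) (ip_norm (ip \<delta>)) (H2_nrm \<Omega>) (E \<delta>) \<le> M" if "\<delta> \<in> I" for \<delta>
    using E_uniform unfolding bdd_above_def by blast
  have "H2_nrm \<Omega> (E \<delta> v) \<le> max M 0 * ip_norm (ip \<delta>) v" if "\<delta> \<in> I" "v \<in> Y \<delta>" for \<delta> v
  proof -
    have "H2_nrm \<Omega> (E \<delta> v) \<le> op_norm (Y \<delta>) (ip_norm (ip \<delta>)) (H2_nrm \<Omega>) (E \<delta>) * ip_norm (ip \<delta>) v"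
      using that by (intro op_norm_bound[OF Y_nrm_nonneg E])
    also have "\<dots> \<le> max M 0 * ip_norm (ip \<delta>) v"
      using M[OF that(1)] Y_nrm_nonneg[OF that] by (intro mult_right_mono) auto
    finally show ?thesis .
  qed
  then show ?thesis by (intro exI[of _ "max M 0"]) auto
qed

lemma Q_bound: "\<exists>CQ\<ge>0. \<forall>\<delta>\<in>I. \<forall>v\<in>H20 \<Omega>. ip_norm (ip \<delta>) (Q \<delta> v) \<le> CQ * H2_nrm \<Omega> v"
proof -
  obtain M where M: "op_norm (H20 \<Omega>) (H2_nrm \<Omega>) (ip_norm (ip \<delta>)) (Q \<delta>) \<le> M" if "\<delta> \<in> I" for \<delta>
    using Q_uniform unfolding bdd_above_def by blast
  have "ip_norm (ip \<delta>) (Q \<delta> v) \<le> max M 0 * H2_nrm \<Omega> v" if "\<delta> \<in> I" "v \<in> H20 \<Omega>" for \<delta> v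
  proof -
    have "ip_norm (ip \<delta>) (Q \<delta> v) \<le> op_norm (H20 \<Omega>) (H2_nrm \<Omega>) (ip_norm (ip \<delta>)) (Q \<delta>) * H2_nrm \<Omega> v"
      using that by (intro op_norm_bound[OF H2_nrm_nonneg Q])
    also have "\<dots> \<le> max M 0 * H2_nrm \<Omega> v"
      using M[OF that(1)] H2_nrm_nonneg by (intro mult_right_mono) auto
    finally show ?thesis .
  qed
  then show ?thesis by (intro exI[of _ "max M 0"]) auto
qed

lemma in_sum:
  assumes "\<delta> \<in> I"
  shows H20_in_sum: "v \<in> H20 \<Omega> \<Longrightarrow> v \<in> set_sum (H20 \<Omega>) (Y \<delta>)"
    and Y_in_sum: "w \<in> Y \<delta> \<Longrightarrow> w \<in> set_sum (H20 \<Omega>) (Y \<delta>)"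
  unfolding set_sum_def using Y_zero[OF assms] H20_zero[OF assms] by force+

text \<open>The decomposition \<open>v = v + 0\<close> competes in the infimum. With its mirror
  image for \<open>Y \<delta>\<close>, one bound for \<open>B \<delta>\<close> on the algebraic sum
  serves both summands.\<close>

lemma sum_norm_le_H2_nrm:
  assumes "\<delta> \<in> I" "v \<in> H20 \<Omega>"
  shows "sum_norm (H20 \<Omega>) (H2_nrm \<Omega>) (Y \<delta>) (ip_norm (ip \<delta>)) v \<le> H2_nrm \<Omega> v"
  using sum_norm_le[of "H20 \<Omega>" "H2_nrm \<Omega>" "Y \<delta>" "ip_norm (ip \<delta>)" v 0, OF H2_nrm_nonneg Y_nrm_nonneg]
    ip_norm_zero[OF Y(3) Y_zero] Y_zero assms by simp

lemma sum_norm_le_Y_nrm: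
  assumes "\<delta> \<in> I" "v \<in> Y \<delta>"
  shows "sum_norm (H20 \<Omega>) (H2_nrm \<Omega>) (Y \<delta>) (ip_norm (ip \<delta>)) v \<le> ip_norm (ip \<delta>) v"
  using sum_norm_le[of "H20 \<Omega>" "H2_nrm \<Omega>" "Y \<delta>" "ip_norm (ip \<delta>)" 0 v, OF H2_nrm_nonneg Y_nrm_nonneg]
    H20_zero H2_nrm_zero assms by simp

lemma B_lin: "\<delta> \<in> I \<Longrightarrow> z \<in> L2 \<Omega> \<Longrightarrow> lin_on (set_sum (H20 \<Omega>) (Y \<delta>)) (B \<delta> z)"
  using B_dual by (auto simp: dual_def)

lemma B_bound:
  assumes "\<delta> \<in> I"
  obtains K where "0 \<le> K" "\<And>z v. z \<in> L2 \<Omega> \<Longrightarrow> v \<in> set_sum (H20 \<Omega>) (Y \<delta>) \<Longrightarrow>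
    \<bar>B \<delta> z v\<bar> \<le> K * L2_nrm z * sum_norm (H20 \<Omega>) (H2_nrm \<Omega>) (Y \<delta>) (ip_norm (ip \<delta>)) v"
proof -
  let ?V = "set_sum (H20 \<Omega>) (Y \<delta>)" and ?n = "sum_norm (H20 \<Omega>) (H2_nrm \<Omega>) (Y \<delta>) (ip_norm (ip \<delta>))"
  have n: "0 \<le> ?n v" if "v \<in> ?V" for v
    using that Y_nrm_nonneg[OF assms] by (intro sum_norm_nonneg H2_nrm_nonneg)
  obtain K where K: "dual_norm ?V ?n (B \<delta> z) \<le> K * L2_nrm z" if "z \<in> L2 \<Omega>" for z
    using B_bounded[OF assms] by blast
  show ?thesis
  proof (rule that[of "max K 0"])
    fix z v assume z: "z \<in> L2 \<Omega>" and v: "v \<in> ?V"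
    have "\<bar>B \<delta> z v\<bar> \<le> dual_norm ?V ?n (B \<delta> z) * ?n v"
      using abs_le_dual_norm[OF n dual_bounded[OF B_dual[OF assms z]] v] by simp
    also have "\<dots> \<le> max K 0 * L2_nrm z * ?n v"
      using K[OF z] n[OF v] L2_nrm_nonneg[of z]
      by (intro mult_right_mono order_trans[OF K[OF z]]) (auto intro: mult_right_mono)
    finally show "\<bar>B \<delta> z v\<bar> \<le> max K 0 * L2_nrm z * ?n v" .
  qed simp
qed

text \<open>By consistency \<open>opB \<Omega>\<close> is the restriction of
  \<open>B \<delta>\<close> to \<open>H20 \<Omega>\<close>, and the sum norm is at most the
  \<open>H2\<close> norm there, so the bound for \<open>B \<delta>\<close> carries over.\<close>

lemma opB_bound:
  assumes "\<delta> \<in> I"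
  obtains K where "0 \<le> K"
    "\<And>z v. z \<in> L2 \<Omega> \<Longrightarrow> v \<in> H20 \<Omega> \<Longrightarrow> \<bar>opB \<Omega> z v\<bar> \<le> K * L2_nrm z * H2_nrm \<Omega> v"
proof -
  obtain K where K: "0 \<le> K" "\<And>z v. z \<in> L2 \<Omega> \<Longrightarrow> v \<in> set_sum (H20 \<Omega>) (Y \<delta>) \<Longrightarrow>
    \<bar>B \<delta> z v\<bar> \<le> K * L2_nrm z * sum_norm (H20 \<Omega>) (H2_nrm \<Omega>) (Y \<delta>) (ip_norm (ip \<delta>)) v"
    using B_bound[OF assms] by blast
  show ?thesis
  proof (rule that[OF K(1)])
    fix z v assume z: "z \<in> L2 \<Omega>" and v: "v \<in> H20 \<Omega>"
    have "K * L2_nrm z * sum_norm (H20 \<Omega>) (H2_nrm \<Omega>) (Y \<delta>) (ip_norm (ip \<delta>)) v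
        \<le> K * L2_nrm z * H2_nrm \<Omega> v"
      using K(1) L2_nrm_nonneg[of z] sum_norm_le_H2_nrm[OF assms v] by (intro mult_left_mono) auto
    with K(2)[OF z H20_in_sum[OF assms v]] show "\<bar>opB \<Omega> z v\<bar> \<le> K * L2_nrm z * H2_nrm \<Omega> v"
      using B_consistent[OF assms z v] by simp
  qed
qed

lemma bounded_functional_opB:
  assumes "\<delta> \<in> I" "z \<in> L2 \<Omega>"
  shows "bounded_functional (H20 \<Omega>) (H2_nrm \<Omega>) (opB \<Omega> z)"
  using opB_bound[OF assms(1)] assms(2) unfolding bounded_functional_def by metis

lemma bounded_functional_B:
  assumes "\<delta> \<in> I" "z \<in> L2 \<Omega>"
  shows "bounded_functional (Y \<delta>) (ip_norm (ip \<delta>)) (B \<delta> z)"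
proof -
  obtain K where K: "0 \<le> K" "\<And>z v. z \<in> L2 \<Omega> \<Longrightarrow> v \<in> set_sum (H20 \<Omega>) (Y \<delta>) \<Longrightarrow>
    \<bar>B \<delta> z v\<bar> \<le> K * L2_nrm z * sum_norm (H20 \<Omega>) (H2_nrm \<Omega>) (Y \<delta>) (ip_norm (ip \<delta>)) v"
    using B_bound[OF assms(1)] by blast
  have "\<bar>B \<delta> z v\<bar> \<le> K * L2_nrm z * ip_norm (ip \<delta>) v" if "v \<in> Y \<delta>" for v
    using K(1) L2_nrm_nonneg[of z] sum_norm_le_Y_nrm[OF assms(1) that]
    by (intro order_trans[OF K(2)[OF assms(2) Y_in_sum[OF assms(1) that]]] mult_left_mono) auto
  then show ?thesis unfolding bounded_functional_def by blast
qed

lemma bounded_functional_E: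
  assumes \<delta>: "\<delta> \<in> I" and f: "bounded_functional (H20 \<Omega>) (H2_nrm \<Omega>) f"
  shows "bounded_functional (Y \<delta>) (ip_norm (ip \<delta>)) (\<lambda>v. f (E \<delta> v))"
proof -
  obtain K where K: "0 \<le> K" "\<And>v. v \<in> H20 \<Omega> \<Longrightarrow> \<bar>f v\<bar> \<le> K * H2_nrm \<Omega> v"
    using bounded_functional_nonneg_bound[OF _ f] H2_nrm_nonneg by blast
  obtain CE where CE: "\<And>v. v \<in> Y \<delta> \<Longrightarrow> H2_nrm \<Omega> (E \<delta> v) \<le> CE * ip_norm (ip \<delta>) v"
    using E_bound \<delta> by blast
  have "\<bar>f (E \<delta> v)\<bar> \<le> K * CE * ip_norm (ip \<delta>) v" if "v \<in> Y \<delta>" for v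
    using K(2)[OF E_in_H20[OF \<delta> that]] mult_left_mono[OF CE[OF that] K(1)] by (simp add: mult.assoc)
  then show ?thesis unfolding bounded_functional_def by blast
qed

text \<open>Linearity in \<open>z\<close> is inherited from \<open>B \<delta>\<close> through
  consistency, instead of being derived from the integral.\<close>

lemma lin_on_opB:
  assumes "\<delta> \<in> I" "v \<in> H20 \<Omega>"
  shows "lin_on (L2 \<Omega>) (\<lambda>z. opB \<Omega> z v)"
  using B_linear[OF assms(1) H20_in_sum[OF assms]] B_consistent[OF assms(1) _ assms(2)]
    subspace_L2[of \<Omega>]
  by (simp add: lin_on_def subspace_add subspace_scale)

text \<open>Consistency replaces \<open>opB\<close> by \<open>B \<delta>\<close> at
  \<open>v\<close>, and Fortin orthogonality replaces \<open>v\<close> by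
  \<open>Q \<delta> v\<close>. The latter is available for trial functions only, hence
  \<open>z \<in> X \<delta>\<close>.\<close>

lemma opB_fortin:
  assumes "\<delta> \<in> I" "z \<in> X \<delta>" "v \<in> H20 \<Omega>"
  shows "opB \<Omega> z v = B \<delta> z (Q \<delta> v)"
proof -
  have z: "z \<in> L2 \<Omega>" using X(2)[OF assms(1)] assms(2) by blast
  have "B \<delta> z (v - Q \<delta> v) = B \<delta> z v - B \<delta> z (Q \<delta> v)"
    using assms z by (intro lin_on_diff[OF B_lin] H20_in_sum Y_in_sum Q_in_Y)
  with Q_fortin[OF assms] B_consistent[OF assms(1) z assms(3)] show ?thesis by simp
qed

text \<open>Here \<open>v\<close> and \<open>E \<delta> v\<close> lie in different summands, so
  linearity of \<open>B \<delta> z\<close> is applied on their algebraic sum; the conforming part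
  then becomes \<open>opB\<close> by consistency.\<close>

lemma B_diff_E:
  assumes "\<delta> \<in> I" "z \<in> L2 \<Omega>" "v \<in> Y \<delta>"
  shows "B \<delta> z (v - E \<delta> v) = B \<delta> z v - opB \<Omega> z (E \<delta> v)"
  using lin_on_diff[OF B_lin[OF assms(1,2)] Y_in_sum[OF assms(1,3)] H20_in_sum[OF assms(1) E_in_H20[OF assms(1,3)]]]
    B_consistent[OF assms(1,2) E_in_H20[OF assms(1,3)]] by simp

section \<open>Residual, consistency error and energy as seminorms\<close>

lemma omega_subset: "\<omega> \<subseteq> \<Omega>"
  using omega(5) closure_subset by blast

lemma omega_measurable: "\<omega> \<in> sets lebesgue"
  using omega(1) by simp

text \<open>Joint source of two seminorms: the least-squares residual with \<open>F\<close> given by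
  \<open>B \<delta>\<close> and \<open>g\<close> by \<open>- ld\<close>, and the consistency error
  with \<open>F\<close> the difference of \<open>B \<delta>\<close> and \<open>opB\<close> after
  \<open>E\<close>, and \<open>g\<close> the mismatch of \<open>l\<close> after \<open>E\<close> and
  \<open>ld\<close>.\<close>

lemma seminorm_on_residual:
  assumes \<delta>: "\<delta> \<in> I" and bdd: "\<And>z. z \<in> L2 \<Omega> \<Longrightarrow> bounded_functional (Y \<delta>) (ip_norm (ip \<delta>)) (F z)"
    and lin: "\<And>v. v \<in> Y \<delta> \<Longrightarrow> lin_on (L2 \<Omega>) (\<lambda>z. F z v)"
    and g: "bounded_functional (Y \<delta>) (ip_norm (ip \<delta>)) g"
  shows "seminorm_on (L2 \<Omega> \<times> UNIV) (\<lambda>(z, t). dual_norm (Y \<delta>) (ip_norm (ip \<delta>)) (\<lambda>v. F z v + t * g v))"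
proof -
  note nY = Y_nrm_nonneg[OF \<delta>]
  have "seminorm_on (L2 \<Omega> \<times> UNIV)
      (\<lambda>x. dual_norm (Y \<delta>) (ip_norm (ip \<delta>)) (\<lambda>v. F (fst x) v + snd x * g v))"
  proof (rule seminorm_on_dual_norm[OF nY _ subspace_Times_UNIV[OF subspace_L2]])
    show "Y \<delta> \<noteq> {}" using Y_zero[OF \<delta>] by blast
    fix x :: "'n aefun \<times> real" assume "x \<in> L2 \<Omega> \<times> UNIV"
    then have "bounded_functional (Y \<delta>) (ip_norm (ip \<delta>)) (F (fst x))" by (intro bdd) auto
    from bounded_functional_lin_comb[OF nY this g, of 1 "snd x"]
    show "bounded_functional (Y \<delta>) (ip_norm (ip \<delta>)) (\<lambda>v. F (fst x) v + snd x * g v)" by simp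
  next
    fix v assume "v \<in> Y \<delta>"
    from lin[OF this] show "lin_on (L2 \<Omega> \<times> UNIV) (\<lambda>x. F (fst x) v + snd x * g v)"
      unfolding lin_on_def by (auto simp: algebra_simps)
  qed
  then show ?thesis by (simp add: case_prod_unfold)
qed

lemma seminorm_on_consistency_error:
  assumes \<delta>: "\<delta> \<in> I" and l: "l \<in> Hm2 \<Omega>" and ld: "ld \<in> dual (Y \<delta>) (ip_norm (ip \<delta>))"
  shows "seminorm_on (L2 \<Omega> \<times> UNIV) (\<lambda>(z, t). dual_norm (Y \<delta>) (ip_norm (ip \<delta>))
    (\<lambda>v. (B \<delta> z v - opB \<Omega> z (E \<delta> v)) + t * (l (E \<delta> v) - ld v)))"
proof (rule seminorm_on_residual[OF \<delta>])
  show "bounded_functional (Y \<delta>) (ip_norm (ip \<delta>)) (\<lambda>v. B \<delta> z v - opB \<Omega> z (E \<delta> v))"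
    if "z \<in> L2 \<Omega>" for z
    using \<delta> that
    by (intro bounded_functional_diff Y_nrm_nonneg bounded_functional_B bounded_functional_E
        bounded_functional_opB)
  show "bounded_functional (Y \<delta>) (ip_norm (ip \<delta>)) (\<lambda>v. l (E \<delta> v) - ld v)"
    using \<delta> dual_bounded[OF l] dual_bounded[OF ld]
    by (intro bounded_functional_diff Y_nrm_nonneg bounded_functional_E)
  show "lin_on (L2 \<Omega>) (\<lambda>z. B \<delta> z v - opB \<Omega> z (E \<delta> v))" if "v \<in> Y \<delta>" for v
    using B_linear[OF \<delta> Y_in_sum[OF \<delta> that]] lin_on_opB[OF \<delta> E_in_H20[OF \<delta> that]]
    by (simp add: lin_on_def algebra_simps)
qed

text \<open>The factor 1 is kept so that the right-hand side is literally the slice t = 1 of the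
  preceding seminorm.\<close>

lemma consistency_error_eq:
  assumes "\<delta> \<in> I" "z \<in> L2 \<Omega>"
  shows "consistency_error (Y \<delta>) (ip \<delta>) (E \<delta>) (B \<delta>) l ld z = dual_norm (Y \<delta>) (ip_norm (ip \<delta>))
    (\<lambda>v. (B \<delta> z v - opB \<Omega> z (E \<delta> v)) + 1 * (l (E \<delta> v) - ld v))"
  unfolding consistency_error_def using B_diff_E[OF assms] by (intro dual_norm_cong) simp

lemma seminorm_on_L2_nrm_affine:
  assumes u: "u \<in> L2 \<Omega>"
  shows "seminorm_on (L2 \<Omega> \<times> UNIV) (\<lambda>(z, t). L2_nrm (t *\<^sub>R u - z))"
proof -
  have "seminorm_on (L2 \<Omega> \<times> UNIV) (\<lambda>x. L2_nrm (snd x *\<^sub>R u - fst x))"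
    using u subspace_L2[of \<Omega>]
    by (intro seminorm_on_linear_vimage[OF seminorm_on_L2_nrm[of \<Omega>]] subspace_Times_UNIV subspace_L2)
       (auto simp: lin_on_def algebra_simps subspace_diff subspace_scale)
  then show ?thesis by (simp add: case_prod_unfold)
qed

text \<open>The root of the least-squares functional, with the data multiplied by \<open>t\<close>:
  the functional itself belongs to t = 1, the data-free energy seminorm to t = 0. The nested roots
  reflect two uses of \<open>seminorm_on_sqrt_sum_squares\<close>.\<close>

definition energy :: "'i \<Rightarrow> real \<Rightarrow> ('n aefun \<Rightarrow> real) \<Rightarrow> 'n aefun \<Rightarrow> 'n aefun \<Rightarrow> real \<Rightarrow> real" where
  "energy \<delta> \<epsilon> ld q z t = sqrt ((sqrt
      ((dual_norm (Y \<delta>) (ip_norm (ip \<delta>)) (\<lambda>v. B \<delta> z v + t * - ld v))\<^sup>2 +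
       (L2_nrm (opC \<omega> z - t *\<^sub>R q))\<^sup>2))\<^sup>2 + (\<epsilon> * L2_nrm z)\<^sup>2)"

lemma seminorm_on_energy:
  assumes \<delta>: "\<delta> \<in> I" and \<epsilon>: "0 \<le> \<epsilon>" and ld: "ld \<in> dual (Y \<delta>) (ip_norm (ip \<delta>))" and q: "q \<in> L2 \<omega>"
  shows "seminorm_on (L2 \<Omega> \<times> UNIV) (\<lambda>(z, t). energy \<delta> \<epsilon> ld q z t)"
proof -
  let ?W = "L2 \<Omega> \<times> (UNIV :: real set)"
  have sub: "subspace ?W" by (rule subspace_Times_UNIV[OF subspace_L2])
  have q: "q \<in> L2 \<Omega>" using q L2_mono[OF omega_subset] by blast
  have "bounded_functional (Y \<delta>) (ip_norm (ip \<delta>)) (\<lambda>v. - ld v)"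
    using dual_bounded[OF ld] by (simp add: bounded_functional_def)
  then have 1: "seminorm_on ?W (\<lambda>(z, t). dual_norm (Y \<delta>) (ip_norm (ip \<delta>)) (\<lambda>v. B \<delta> z v + t * - ld v))"
    by (intro seminorm_on_residual[OF \<delta>] bounded_functional_B[OF \<delta>] B_linear[OF \<delta>] Y_in_sum[OF \<delta>])
  have lin: "lin_on ?W (\<lambda>x. opC \<omega> (fst x) - snd x *\<^sub>R q)"
    using lin_on_opC[of UNIV \<omega>] by (simp add: lin_on_def algebra_simps)
  have 2: "seminorm_on ?W (\<lambda>x. L2_nrm (opC \<omega> (fst x) - snd x *\<^sub>R q))"
    using q opC_in_L2[OF omega_measurable] subspace_L2[of \<Omega>]
    by (intro seminorm_on_linear_vimage[OF seminorm_on_L2_nrm[of \<Omega>] sub _ lin])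
       (auto simp: subspace_diff subspace_scale)
  have "seminorm_on ?W (\<lambda>x. L2_nrm (fst x))"
    by (intro seminorm_on_linear_vimage[OF seminorm_on_L2_nrm[of \<Omega>] sub]) (auto simp: lin_on_def)
  then have 3: "seminorm_on ?W (\<lambda>x. \<epsilon> * L2_nrm (fst x))" by (rule seminorm_on_cmult[OF \<epsilon>])
  from seminorm_on_sqrt_sum_squares[OF seminorm_on_sqrt_sum_squares[OF 1 2] 3]
  show ?thesis by (simp add: energy_def case_prod_unfold)
qed

lemma least_squares_functional_eq:
  "least_squares_functional \<omega> (Y \<delta>) (ip \<delta>) (B \<delta>) \<epsilon> ld q z = (energy \<delta> \<epsilon> ld q z 1)\<^sup>2"
  by (simp add: least_squares_functional_def energy_def power_mult_distrib)

lemma energy_nonneg: "0 \<le> energy \<delta> \<epsilon> ld q z t"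
  by (simp add: energy_def)

lemma energy_ge:
  "\<bar>dual_norm (Y \<delta>) (ip_norm (ip \<delta>)) (\<lambda>v. B \<delta> z v + t * - ld v)\<bar> \<le> energy \<delta> \<epsilon> ld q z t"
  "\<bar>L2_nrm (opC \<omega> z - t *\<^sub>R q)\<bar> \<le> energy \<delta> \<epsilon> ld q z t"
  "\<bar>\<epsilon> * L2_nrm z\<bar> \<le> energy \<delta> \<epsilon> ld q z t"
  unfolding energy_def by (rule real_le_rsqrt; simp)+

lemma energy_le:
  assumes "0 \<le> dual_norm (Y \<delta>) (ip_norm (ip \<delta>)) (\<lambda>v. B \<delta> z v + t * - ld v)" "0 \<le> \<epsilon>"
  shows "energy \<delta> \<epsilon> ld q z t \<le> dual_norm (Y \<delta>) (ip_norm (ip \<delta>)) (\<lambda>v. B \<delta> z v + t * - ld v)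
    + L2_nrm (opC \<omega> z - t *\<^sub>R q) + \<epsilon> * L2_nrm z"
  unfolding energy_def using assms L2_nrm_nonneg
  by (intro order_trans[OF sqrt_sum_squares_le_sum] add_right_mono sqrt_sum_squares_le_sum) auto

text \<open>Squaring is strictly increasing on nonnegative reals, so minimising the functional
  amounts to minimising its root, for which the seminorm results are available.\<close>

lemma is_minimizer_iff:
  "is_minimizer \<omega> (X \<delta>) (Y \<delta>) (ip \<delta>) (B \<delta>) \<epsilon> ld q ud \<longleftrightarrow>
     ud \<in> X \<delta> \<and> (\<forall>z\<in>X \<delta>. energy \<delta> \<epsilon> ld q ud 1 \<le> energy \<delta> \<epsilon> ld q z 1)"
proof -
  have "(energy \<delta> \<epsilon> ld q z 1)\<^sup>2 < (energy \<delta> \<epsilon> ld q ud 1)\<^sup>2 \<longleftrightarrow> energy \<delta> \<epsilon> ld q z 1 < energy \<delta> \<epsilon> ld q ud 1" for z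
    using power_strict_mono[of "energy \<delta> \<epsilon> ld q z 1"] power2_less_imp_less[OF _ energy_nonneg] energy_nonneg by auto
  then show ?thesis
    unfolding is_minimizer_def is_arg_min_def least_squares_functional_eq by (auto simp: not_less)
qed

lemma minimizer_exists:
  assumes "\<delta> \<in> I" "0 \<le> \<epsilon>" "ld \<in> dual (Y \<delta>) (ip_norm (ip \<delta>))" "q \<in> L2 \<omega>"
  shows "\<exists>ud. is_minimizer \<omega> (X \<delta>) (Y \<delta>) (ip \<delta>) (B \<delta>) \<epsilon> ld q ud"
  using seminorm_on_affine_attains_min[OF seminorm_on_energy[OF assms] X[OF assms(1)]]
  unfolding is_minimizer_iff by blast

lemma best_approximation_exists:
  assumes "\<delta> \<in> I" "u \<in> L2 \<Omega>"
  obtains z where "z \<in> X \<delta>" "\<And>z'. z' \<in> X \<delta> \<Longrightarrow> L2_nrm (u - z) \<le> L2_nrm (u - z')"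
  using seminorm_on_affine_attains_min[OF seminorm_on_L2_nrm_affine[OF assms(2)] X[OF assms(1)]]
  by auto

text \<open>Both summands are slices at t = 1 of seminorms in \<open>(z, t)\<close>, hence so is
  their sum. Attainment matters because \<open>min_over\<close> is a least value, and its evaluation
  rests on a minimiser.\<close>

lemma approximation_consistency_min_exists:
  assumes \<delta>: "\<delta> \<in> I" and u: "u \<in> L2 \<Omega>" and l: "l \<in> Hm2 \<Omega>" "ld \<in> dual (Y \<delta>) (ip_norm (ip \<delta>))"
  obtains z where "z \<in> X \<delta>" "\<And>z'. z' \<in> X \<delta> \<Longrightarrow>
    L2_nrm (u - z) + consistency_error (Y \<delta>) (ip \<delta>) (E \<delta>) (B \<delta>) l ld z
      \<le> L2_nrm (u - z') + consistency_error (Y \<delta>) (ip \<delta>) (E \<delta>) (B \<delta>) l ld z'"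
proof -
  have "seminorm_on (L2 \<Omega> \<times> UNIV) (\<lambda>(z, t). L2_nrm (t *\<^sub>R u - z) + dual_norm (Y \<delta>) (ip_norm (ip \<delta>))
      (\<lambda>v. (B \<delta> z v - opB \<Omega> z (E \<delta> v)) + t * (l (E \<delta> v) - ld v)))"
    using seminorm_on_plus[OF seminorm_on_L2_nrm_affine[OF u] seminorm_on_consistency_error[OF \<delta> l]]
    by (simp add: case_prod_unfold)
  from seminorm_on_affine_attains_min[OF this X[OF \<delta>]]
  obtain z where z: "z \<in> X \<delta>" "\<forall>z'\<in>X \<delta>.
      L2_nrm (1 *\<^sub>R u - z) + dual_norm (Y \<delta>) (ip_norm (ip \<delta>))
        (\<lambda>v. (B \<delta> z v - opB \<Omega> z (E \<delta> v)) + 1 * (l (E \<delta> v) - ld v))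
      \<le> L2_nrm (1 *\<^sub>R u - z') + dual_norm (Y \<delta>) (ip_norm (ip \<delta>))
        (\<lambda>v. (B \<delta> z' v - opB \<Omega> z' (E \<delta> v)) + 1 * (l (E \<delta> v) - ld v))" by blast
  have X_L2: "x \<in> L2 \<Omega>" if "x \<in> X \<delta>" for x using X(2)[OF \<delta>] that by blast
  show ?thesis
    using z that[of z] by (simp add: consistency_error_eq[OF \<delta> X_L2])
qed

section \<open>Stability and error estimates\<close>

lemma consistency_error_nonneg:
  assumes "\<delta> \<in> I" "z \<in> L2 \<Omega>" "l \<in> Hm2 \<Omega>" "ld \<in> dual (Y \<delta>) (ip_norm (ip \<delta>))"
  shows "0 \<le> consistency_error (Y \<delta>) (ip \<delta>) (E \<delta>) (B \<delta>) l ld z"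
  using seminorm_on_nonneg[OF seminorm_on_consistency_error[OF assms(1,3,4)], of "(z, 1)"] assms(2)
  unfolding consistency_error_eq[OF assms(1,2)] by simp

text \<open>The triangle inequality is applied to \<open>(z, 1) - (ud, 1) = (z - ud, 0)\<close>. The
  factor 2 arises because the residual of \<open>ud\<close> is at most that of
  \<open>z\<close>.\<close>

lemma energy_diff_le:
  assumes "\<delta> \<in> I" "0 \<le> \<epsilon>" "ld \<in> dual (Y \<delta>) (ip_norm (ip \<delta>))" "q \<in> L2 \<omega>"
    and ud: "is_minimizer \<omega> (X \<delta>) (Y \<delta>) (ip \<delta>) (B \<delta>) \<epsilon> ld q ud" and z: "z \<in> X \<delta>"
  shows "energy \<delta> \<epsilon> ld q (z - ud) 0 \<le> 2 * energy \<delta> \<epsilon> ld q z 1"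
proof -
  have "z \<in> L2 \<Omega>" "ud \<in> L2 \<Omega>" and min: "energy \<delta> \<epsilon> ld q ud 1 \<le> energy \<delta> \<epsilon> ld q z 1"
    using ud z X(2)[OF assms(1)] unfolding is_minimizer_iff by auto
  then have "energy \<delta> \<epsilon> ld q (z - ud) 0 \<le> energy \<delta> \<epsilon> ld q z 1 + energy \<delta> \<epsilon> ld q ud 1"
    using seminorm_on_diff[OF seminorm_on_energy[OF assms(1-4)], of "(z, 1)" "(ud, 1)"] by simp
  with min show ?thesis by linarith
qed

text \<open>Fortin's criterion: \<open>opB \<Omega> w v\<close> equals
  \<open>B \<delta> w (Q \<delta> v)\<close>, and the norm of \<open>Q \<delta> v\<close> costs the
  factor \<open>CQ\<close>. Discrete test functions thus control the full dual norm on the trial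
  space.\<close>

lemma Hm2_nrm_opB_le_discrete:
  assumes \<delta>: "\<delta> \<in> I" and w: "w \<in> X \<delta>" and CQ: "0 \<le> CQ"
    "\<And>v. v \<in> H20 \<Omega> \<Longrightarrow> ip_norm (ip \<delta>) (Q \<delta> v) \<le> CQ * H2_nrm \<Omega> v"
  shows "Hm2_nrm \<Omega> (opB \<Omega> w) \<le> CQ * dual_norm (Y \<delta>) (ip_norm (ip \<delta>)) (B \<delta> w)"
proof -
  let ?d = "dual_norm (Y \<delta>) (ip_norm (ip \<delta>)) (B \<delta> w)"
  have bdd: "bounded_functional (Y \<delta>) (ip_norm (ip \<delta>)) (B \<delta> w)"
    using w X(2)[OF \<delta>] by (intro bounded_functional_B[OF \<delta>]) auto
  have d: "0 \<le> ?d" using Y_zero[OF \<delta>] by (intro dual_norm_nonneg[OF Y_nrm_nonneg[OF \<delta>] bdd]) auto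
  show ?thesis
  proof (rule dual_norm_le[OF H2_nrm_nonneg])
    show "H20 \<Omega> \<noteq> {}" using H20_zero[OF \<delta>] by blast
    show "0 \<le> CQ * ?d" using CQ(1) d by simp
    fix v assume v: "v \<in> H20 \<Omega>"
    have "\<bar>opB \<Omega> w v\<bar> \<le> ?d * ip_norm (ip \<delta>) (Q \<delta> v)"
      unfolding opB_fortin[OF \<delta> w v]
      by (rule abs_le_dual_norm[OF Y_nrm_nonneg[OF \<delta>] bdd Q_in_Y[OF \<delta> v]])
    also have "\<dots> \<le> ?d * (CQ * H2_nrm \<Omega> v)" using CQ(2)[OF v] d by (rule mult_left_mono)
    finally show "\<bar>opB \<Omega> w v\<bar> \<le> CQ * ?d * H2_nrm \<Omega> v" by (simp add: mult_ac)
  qed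
qed

lemma Hm2_nrm_opB_triangle:
  assumes \<delta>: "\<delta> \<in> I" and x: "x \<in> L2 \<Omega>" and y: "y \<in> L2 \<Omega>"
  shows "Hm2_nrm \<Omega> (opB \<Omega> (x + y)) \<le> Hm2_nrm \<Omega> (opB \<Omega> x) + Hm2_nrm \<Omega> (opB \<Omega> y)"
proof -
  have "Hm2_nrm \<Omega> (opB \<Omega> (x + y)) = Hm2_nrm \<Omega> (\<lambda>v. opB \<Omega> x v + opB \<Omega> y v)"
    by (intro dual_norm_cong) (simp add: lin_on_add[OF lin_on_opB[OF \<delta>] x y])
  also have "\<dots> \<le> Hm2_nrm \<Omega> (opB \<Omega> x) + Hm2_nrm \<Omega> (opB \<Omega> y)"
    using H20_zero[OF \<delta>] bounded_functional_opB[OF \<delta>] x y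
    by (intro dual_norm_triangle H2_nrm_nonneg) auto
  finally show ?thesis .
qed

lemma Hm2_nrm_opB_nonneg: "\<delta> \<in> I \<Longrightarrow> z \<in> L2 \<Omega> \<Longrightarrow> 0 \<le> Hm2_nrm \<Omega> (opB \<Omega> z)"
  using H20_zero bounded_functional_opB by (intro dual_norm_nonneg H2_nrm_nonneg) auto

lemma bounded_functional_residual:
  assumes "\<delta> \<in> I" "z \<in> L2 \<Omega>" "l \<in> Hm2 \<Omega>"
  shows "bounded_functional (H20 \<Omega>) (H2_nrm \<Omega>) (\<lambda>v. opB \<Omega> z v - l v)"
  using assms by (intro bounded_functional_diff H2_nrm_nonneg bounded_functional_opB dual_bounded)

text \<open>The residual of \<open>z\<close> at \<open>v\<close> is the consistency term, plus the
  residual of \<open>u\<close> at \<open>E \<delta> v\<close>, minus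
  \<open>opB \<Omega> (u - z)\<close> at \<open>E \<delta> v\<close>. The last two are continuous
  dual norms times the norm of \<open>E \<delta> v\<close>, which brings in
  \<open>CE\<close>.\<close>

lemma discrete_residual_le:
  assumes \<delta>: "\<delta> \<in> I" and z: "z \<in> L2 \<Omega>" and u: "u \<in> L2 \<Omega>"
    and l: "l \<in> Hm2 \<Omega>" "ld \<in> dual (Y \<delta>) (ip_norm (ip \<delta>))"
    and CE: "0 \<le> CE" "\<And>v. v \<in> Y \<delta> \<Longrightarrow> H2_nrm \<Omega> (E \<delta> v) \<le> CE * ip_norm (ip \<delta>) v"
    and KB: "Hm2_nrm \<Omega> (opB \<Omega> (u - z)) \<le> b"
  shows "dual_norm (Y \<delta>) (ip_norm (ip \<delta>)) (\<lambda>v. B \<delta> z v + 1 * - ld v)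
    \<le> consistency_error (Y \<delta>) (ip \<delta>) (E \<delta>) (B \<delta>) l ld z + CE * (b + data_error \<Omega> \<omega> u l q)"
proof (rule dual_norm_le[OF Y_nrm_nonneg[OF \<delta>]])
  let ?nY = "ip_norm (ip \<delta>)"
  let ?c = "consistency_error (Y \<delta>) (ip \<delta>) (E \<delta>) (B \<delta>) l ld z"
  let ?G = "\<lambda>v. (B \<delta> z v - opB \<Omega> z (E \<delta> v)) + 1 * (l (E \<delta> v) - ld v)"
  let ?r = "Hm2_nrm \<Omega> (\<lambda>v. opB \<Omega> u v - l v)"
  have uz: "u - z \<in> L2 \<Omega>" using u z subspace_L2[of \<Omega>] by (simp add: subspace_diff)
  have r: "?r \<le> data_error \<Omega> \<omega> u l q"
    unfolding data_error_def using data_nrm_ge(1) by (rule order_trans[OF abs_ge_self])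
  have r0: "0 \<le> ?r"
    using H20_zero[OF \<delta>] bounded_functional_residual[OF \<delta> u l(1)]
    by (intro dual_norm_nonneg H2_nrm_nonneg) auto
  have b0: "0 \<le> b" using KB Hm2_nrm_opB_nonneg[OF \<delta> uz] by linarith
  show "Y \<delta> \<noteq> {}" using Y_zero[OF \<delta>] by blast
  show "0 \<le> ?c + CE * (b + data_error \<Omega> \<omega> u l q)"
    using consistency_error_nonneg[OF \<delta> z l] CE(1) b0 r r0 by simp
  fix v assume v: "v \<in> Y \<delta>"
  have Ev: "E \<delta> v \<in> H20 \<Omega>" using E_in_H20[OF \<delta> v] .
  have "bounded_functional (Y \<delta>) ?nY (\<lambda>v. (B \<delta> z v - opB \<Omega> z (E \<delta> v)) + (l (E \<delta> v) - ld v))"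
    using \<delta> z dual_bounded[OF l(1)] dual_bounded[OF l(2)]
    by (intro bounded_functional_add bounded_functional_diff Y_nrm_nonneg bounded_functional_B
        bounded_functional_E bounded_functional_opB)
  then have bG: "bounded_functional (Y \<delta>) ?nY ?G" by simp
  have 1: "\<bar>?G v\<bar> \<le> ?c * ?nY v"
    unfolding consistency_error_eq[OF \<delta> z] by (rule abs_le_dual_norm[OF Y_nrm_nonneg[OF \<delta>] bG v])
  have "\<bar>opB \<Omega> (u - z) (E \<delta> v)\<bar> \<le> Hm2_nrm \<Omega> (opB \<Omega> (u - z)) * H2_nrm \<Omega> (E \<delta> v)"
    by (rule abs_le_dual_norm[OF H2_nrm_nonneg bounded_functional_opB[OF \<delta> uz] Ev])
  also have "\<dots> \<le> b * H2_nrm \<Omega> (E \<delta> v)"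
    using KB H2_nrm_nonneg by (rule mult_right_mono)
  finally have 2: "\<bar>opB \<Omega> (u - z) (E \<delta> v)\<bar> \<le> b * H2_nrm \<Omega> (E \<delta> v)" .
  have "\<bar>opB \<Omega> u (E \<delta> v) - l (E \<delta> v)\<bar> \<le> ?r * H2_nrm \<Omega> (E \<delta> v)"
    by (rule abs_le_dual_norm[OF H2_nrm_nonneg bounded_functional_residual[OF \<delta> u l(1)] Ev])
  also have "\<dots> \<le> data_error \<Omega> \<omega> u l q * H2_nrm \<Omega> (E \<delta> v)"
    using r H2_nrm_nonneg by (rule mult_right_mono)
  finally have 3: "\<bar>opB \<Omega> u (E \<delta> v) - l (E \<delta> v)\<bar> \<le> data_error \<Omega> \<omega> u l q * H2_nrm \<Omega> (E \<delta> v)" .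
  have "(b + data_error \<Omega> \<omega> u l q) * H2_nrm \<Omega> (E \<delta> v) \<le> (b + data_error \<Omega> \<omega> u l q) * (CE * ?nY v)"
    using CE(2)[OF v] b0 r r0 by (intro mult_left_mono) auto
  moreover have "B \<delta> z v + 1 * - ld v
      = ?G v + (opB \<Omega> u (E \<delta> v) - l (E \<delta> v)) - opB \<Omega> (u - z) (E \<delta> v)"
    by (simp add: lin_on_diff[OF lin_on_opB[OF \<delta> Ev] u z])
  ultimately have "\<bar>B \<delta> z v + 1 * - ld v\<bar> \<le> ?c * ?nY v + (b + data_error \<Omega> \<omega> u l q) * (CE * ?nY v)"
    using 1 2 3 by (simp add: distrib_right)
  then show "\<bar>B \<delta> z v + 1 * - ld v\<bar> \<le> (?c + CE * (b + data_error \<Omega> \<omega> u l q)) * ?nY v"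
    by (simp add: algebra_simps)
qed

lemma data_error_nonneg: "0 \<le> data_error \<Omega> \<omega> u l q"
  unfolding data_error_def by (rule order_trans[OF abs_ge_zero data_nrm_ge(1)])

text \<open>Each of the three parts of the energy of \<open>z\<close> is compared with the
  corresponding quantity for \<open>u\<close>; the differences are controlled by
  \<open>u - z\<close>, the data error and the consistency error.\<close>

lemma energy_le_errors:
  assumes \<delta>: "\<delta> \<in> I" and \<epsilon>: "\<epsilon> \<in> {0..\<epsilon>0}" and z: "z \<in> L2 \<Omega>" and u: "u \<in> L2 \<Omega>" and q: "q \<in> L2 \<omega>"
    and l: "l \<in> Hm2 \<Omega>" "ld \<in> dual (Y \<delta>) (ip_norm (ip \<delta>))"
    and CE: "0 \<le> CE" "\<And>v. v \<in> Y \<delta> \<Longrightarrow> H2_nrm \<Omega> (E \<delta> v) \<le> CE * ip_norm (ip \<delta>) v"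
    and KB: "0 \<le> KB" "Hm2_nrm \<Omega> (opB \<Omega> (u - z)) \<le> KB * L2_nrm (u - z)"
  shows "energy \<delta> \<epsilon> ld q z 1 \<le> (2 + CE + CE * KB + \<epsilon>0) * (data_error \<Omega> \<omega> u l q + \<epsilon> * L2_nrm u +
    (L2_nrm (u - z) + consistency_error (Y \<delta>) (ip \<delta>) (E \<delta>) (B \<delta>) l ld z))"
proof -
  define m D c e where "m = L2_nrm (u - z)" and "D = data_error \<Omega> \<omega> u l q"
    and "c = consistency_error (Y \<delta>) (ip \<delta>) (E \<delta>) (B \<delta>) l ld z" and "e = \<epsilon> * L2_nrm u"
  have q': "q \<in> L2 \<Omega>" using q L2_mono[OF omega_subset] by blast
  have uz: "u - z \<in> L2 \<Omega>" using u z subspace_L2[of \<Omega>] by (simp add: subspace_diff)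
  have nn: "0 \<le> m" "0 \<le> D" "0 \<le> c" "0 \<le> e"
    using L2_nrm_nonneg[of u] L2_nrm_nonneg[of "u - z"] data_error_nonneg consistency_error_nonneg[OF \<delta> z l] \<epsilon>
    by (simp_all add: m_def D_def c_def e_def)
  have "dual_norm (Y \<delta>) (ip_norm (ip \<delta>)) (\<lambda>v. B \<delta> z v + 1 * - ld v) \<le> c + CE * (KB * m + D)"
    unfolding c_def D_def m_def by (rule discrete_residual_le[OF \<delta> z u l CE KB(2)])
  moreover have "L2_nrm (opC \<omega> z - q) \<le> D + m"
  proof -
    \<comment> \<open>The observation misfit of \<open>z\<close> is reduced to that of
      \<open>u\<close>, up to the restriction of \<open>u - z\<close>.\<close>
    have eq: "opC \<omega> z - q = (opC \<omega> u - q) - opC \<omega> (u - z)"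
      using lin_on_diff[OF lin_on_opC[of UNIV \<omega>], of u z] by simp
    have "L2_nrm (opC \<omega> z - q) \<le> L2_nrm (opC \<omega> u - q) + L2_nrm (opC \<omega> (u - z))"
      unfolding eq
      by (intro seminorm_on_diff[OF seminorm_on_L2_nrm[of \<Omega>]] subspace_diff[OF subspace_L2]
          opC_in_L2[OF omega_measurable] u uz q')
    also have "\<dots> \<le> D + m"
      unfolding D_def m_def data_error_def
      by (intro add_mono L2_nrm_opC_le[OF omega_measurable uz] order_trans[OF abs_ge_self data_nrm_ge(2)])
    finally show ?thesis .
  qed
  \<comment> \<open>Here \<epsilon> \<le> \<epsilon>0 is used: the regularisation of
    \<open>z\<close> is paid for by that of \<open>u\<close> and by the approximation error.\<close>
  moreover have "\<epsilon> * L2_nrm z \<le> e + \<epsilon>0 * m"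
  proof -
    have "L2_nrm z \<le> L2_nrm u + m"
      using seminorm_on_diff[OF seminorm_on_L2_nrm[of \<Omega>] u uz] by (simp add: m_def)
    then have "\<epsilon> * L2_nrm z \<le> \<epsilon> * L2_nrm u + \<epsilon> * m"
      using \<epsilon> by (simp add: mult_left_mono flip: distrib_left)
    also have "\<dots> \<le> e + \<epsilon>0 * m" using \<epsilon> nn(1) by (simp add: e_def mult_right_mono)
    finally show ?thesis .
  qed
  moreover have "energy \<delta> \<epsilon> ld q z 1 \<le> dual_norm (Y \<delta>) (ip_norm (ip \<delta>)) (\<lambda>v. B \<delta> z v + 1 * - ld v)
      + L2_nrm (opC \<omega> z - 1 *\<^sub>R q) + \<epsilon> * L2_nrm z"
  proof (rule energy_le)
    have "bounded_functional (Y \<delta>) (ip_norm (ip \<delta>)) (\<lambda>v. B \<delta> z v - ld v)"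
      by (intro bounded_functional_diff Y_nrm_nonneg[OF \<delta>] bounded_functional_B[OF \<delta> z] dual_bounded[OF l(2)])
    then show "0 \<le> dual_norm (Y \<delta>) (ip_norm (ip \<delta>)) (\<lambda>v. B \<delta> z v + 1 * - ld v)"
      using Y_zero[OF \<delta>] by (intro dual_norm_nonneg Y_nrm_nonneg[OF \<delta>]) auto
  qed (use \<epsilon> in simp)
  ultimately have "energy \<delta> \<epsilon> ld q z 1 \<le> c + CE * (KB * m + D) + (D + m) + (e + \<epsilon>0 * m)" by simp
  also have "\<dots> \<le> (2 + CE + CE * KB + \<epsilon>0) * (D + e + (m + c))"
  proof -
    have "0 \<le> \<epsilon>0" using \<epsilon> by simp
    \<comment> \<open>The coefficients collected so far are 1 + CE for \<open>D\<close>, 1 for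
      \<open>e\<close> and \<open>c\<close>, and 1 + CE * KB + \<epsilon>0 for \<open>m\<close>.
      This expression is the surplus of the common constant over them.\<close>
    then have "0 \<le> (1 + CE * KB + \<epsilon>0) * D + (1 + CE + CE * KB + \<epsilon>0) * e + (1 + CE) * m
        + (1 + CE + CE * KB + \<epsilon>0) * c"
      using nn CE(1) KB(1) by (intro add_nonneg_nonneg mult_nonneg_nonneg) auto
    also have "\<dots> = (2 + CE + CE * KB + \<epsilon>0) * (D + e + (m + c))
        - (c + CE * (KB * m + D) + (D + m) + (e + \<epsilon>0 * m))"
      by (simp add: algebra_simps)
    finally show ?thesis by simp
  qed
  finally show ?thesis by (simp only: m_def D_def c_def e_def)
qed

text \<open>Split \<open>u - ud\<close> into \<open>u - z\<close> and the trial function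
  \<open>z - ud\<close>. The latter contributes \<open>CQ\<close> through the Fortin bound and 1
  each through the observation and the regularisation, giving \<open>CQ + 2\<close>; the
  coefficients KB, 1 and \<epsilon>0 of \<open>u - z\<close> arise in the same way.\<close>

lemma total_error_le_energy:
  assumes \<delta>: "\<delta> \<in> I" and \<epsilon>: "\<epsilon> \<in> {0..\<epsilon>0}" and u: "u \<in> L2 \<Omega>" and z: "z \<in> X \<delta>" and ud: "ud \<in> X \<delta>"
    and CQ: "0 \<le> CQ" "\<And>v. v \<in> H20 \<Omega> \<Longrightarrow> ip_norm (ip \<delta>) (Q \<delta> v) \<le> CQ * H2_nrm \<Omega> v"
    and KB: "Hm2_nrm \<Omega> (opB \<Omega> (u - z)) \<le> KB * L2_nrm (u - z)"
  shows "total_error \<Omega> \<omega> \<epsilon> u ud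
    \<le> (KB + 1 + \<epsilon>0) * L2_nrm (u - z) + (CQ + 2) * energy \<delta> \<epsilon> ld q (z - ud) 0"
proof -
  define w J m where "w = z - ud" and "J = energy \<delta> \<epsilon> ld q w 0" and "m = L2_nrm (u - z)"
  have subX: "subspace (X \<delta>)" using X(1)[OF \<delta>] by (auto simp: finite_dim_subspace_def)
  have wX: "w \<in> X \<delta>" using z ud subX by (simp add: w_def subspace_diff)
  then have w: "w \<in> L2 \<Omega>" using X(2)[OF \<delta>] by blast
  have uz: "u - z \<in> L2 \<Omega>" using u z X(2)[OF \<delta>] subspace_L2[of \<Omega>] by (auto simp: subspace_diff)
  have split: "u - ud = (u - z) + w" by (simp add: w_def)
  then have uud: "u - ud \<in> L2 \<Omega>" using subspace_add[OF subspace_L2 uz w] by (simp only:)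
  \<comment> \<open>At t = 0 the terms with \<open>ld\<close> and \<open>q\<close> vanish, so the
    energy dominates the pure norms of \<open>w\<close>.\<close>
  have J: "dual_norm (Y \<delta>) (ip_norm (ip \<delta>)) (B \<delta> w) \<le> J" "L2_nrm (opC \<omega> w) \<le> J" "\<epsilon> * L2_nrm w \<le> J"
    unfolding J_def
    using energy_ge[where \<delta> = \<delta> and z = w and t = 0 and ld = ld and \<epsilon> = \<epsilon> and q = q] by auto
  have "Hm2_nrm \<Omega> (opB \<Omega> (u - ud)) \<le> KB * m + CQ * J"
  proof -
    have "Hm2_nrm \<Omega> (opB \<Omega> (u - ud)) \<le> Hm2_nrm \<Omega> (opB \<Omega> (u - z)) + Hm2_nrm \<Omega> (opB \<Omega> w)"
      unfolding split by (rule Hm2_nrm_opB_triangle[OF \<delta> uz w])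
    moreover have "Hm2_nrm \<Omega> (opB \<Omega> w) \<le> CQ * J"
      using Hm2_nrm_opB_le_discrete[OF \<delta> wX CQ] mult_left_mono[OF J(1) CQ(1)] by linarith
    ultimately show ?thesis using KB by (simp add: m_def)
  qed
  moreover have "L2_nrm (opC \<omega> (u - ud)) \<le> m + J"
  proof -
    have "opC \<omega> (u - ud) = opC \<omega> (u - z) + opC \<omega> w"
      unfolding split by (rule lin_on_add[OF lin_on_opC[of UNIV]]) simp_all
    then have "L2_nrm (opC \<omega> (u - ud)) \<le> L2_nrm (opC \<omega> (u - z)) + L2_nrm (opC \<omega> w)"
      using seminorm_on_add[OF seminorm_on_L2_nrm[of \<Omega>] opC_in_L2[OF omega_measurable uz]
          opC_in_L2[OF omega_measurable w]] by simp
    with J(2) L2_nrm_opC_le[OF omega_measurable uz] show ?thesis by (simp add: m_def)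
  qed
  moreover have "\<epsilon> * L2_nrm (u - ud) \<le> \<epsilon>0 * m + J"
  proof -
    have "\<epsilon> * L2_nrm (u - ud) \<le> \<epsilon> * (m + L2_nrm w)"
      using seminorm_on_add[OF seminorm_on_L2_nrm[of \<Omega>] uz w] \<epsilon>
      unfolding split m_def by (intro mult_left_mono) auto
    moreover have "\<epsilon> * m \<le> \<epsilon>0 * m" using \<epsilon> L2_nrm_nonneg by (intro mult_right_mono) (auto simp: m_def)
    ultimately show ?thesis using J(3) by (simp add: distrib_left)
  qed
  moreover have "total_error \<Omega> \<omega> \<epsilon> u ud
      \<le> Hm2_nrm \<Omega> (opB \<Omega> (u - ud)) + L2_nrm (opC \<omega> (u - ud)) + \<epsilon> * L2_nrm (u - ud)"
    unfolding total_error_def using data_nrm_le[OF Hm2_nrm_opB_nonneg[OF \<delta> uud]] by simp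
  ultimately have "total_error \<Omega> \<omega> \<epsilon> u ud \<le> (KB * m + CQ * J) + (m + J) + (\<epsilon>0 * m + J)" by linarith
  then show ?thesis unfolding J_def m_def w_def by (simp add: algebra_simps)
qed

section \<open>The a priori bound and its consequence\<close>

lemma a_priori_bound_exists: "\<exists>K. a_priori_bound \<Omega> \<omega> I X Y ip E B \<epsilon>0 K"
proof (cases "I = {}")
  \<comment> \<open>The constant for \<open>opB\<close> is extracted at some index, so the empty
    family, where the bound is vacuous, is treated apart.\<close>
  case True
  then show ?thesis by (simp add: a_priori_bound_def)
next
  case False
  obtain CE where CE: "0 \<le> CE" "\<And>\<delta> v. \<delta> \<in> I \<Longrightarrow> v \<in> Y \<delta> \<Longrightarrow> H2_nrm \<Omega> (E \<delta> v) \<le> CE * ip_norm (ip \<delta>) v"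
    using E_bound by blast
  obtain CQ where CQ: "0 \<le> CQ" "\<And>\<delta> v. \<delta> \<in> I \<Longrightarrow> v \<in> H20 \<Omega> \<Longrightarrow> ip_norm (ip \<delta>) (Q \<delta> v) \<le> CQ * H2_nrm \<Omega> v"
    using Q_bound by blast
  \<comment> \<open>\<open>opB\<close> does not depend on \<open>\<delta>\<close>, so a bound obtained at one index is uniform.\<close>
  obtain KB where KB: "0 \<le> KB"
    "\<And>z v. z \<in> L2 \<Omega> \<Longrightarrow> v \<in> H20 \<Omega> \<Longrightarrow> \<bar>opB \<Omega> z v\<bar> \<le> KB * L2_nrm z * H2_nrm \<Omega> v"
    using opB_bound False by blast
  define M where "M = 2 + CE + CE * KB + \<epsilon>0"
  \<comment> \<open>The first three terms multiply the error \<open>u - z\<close>. In the product,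
    \<open>CQ + 2\<close> passes from the energy of \<open>z - ud\<close> to the total error, 2
    comes from minimality, and \<open>M\<close> bounds the energy of \<open>z\<close> by the
    right-hand side.\<close>
  have "a_priori_bound \<Omega> \<omega> I X Y ip E B \<epsilon>0 (KB + 1 + \<epsilon>0 + (CQ + 2) * (2 * M))"
    unfolding a_priori_bound_def
  proof (intro ballI allI impI)
    fix \<delta> \<epsilon> l ld q u ud
    assume \<delta>: "\<delta> \<in> I" and \<epsilon>: "\<epsilon> \<in> {0..\<epsilon>0}" and l: "l \<in> Hm2 \<Omega>" and ld: "ld \<in> dual (Y \<delta>) (ip_norm (ip \<delta>))"
      and q: "q \<in> L2 \<omega>" and u: "u \<in> L2 \<Omega>"
      and ud: "is_minimizer \<omega> (X \<delta>) (Y \<delta>) (ip \<delta>) (B \<delta>) \<epsilon> ld q ud"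
    let ?F = "\<lambda>z. L2_nrm (u - z) + consistency_error (Y \<delta>) (ip \<delta>) (E \<delta>) (B \<delta>) l ld z"
    obtain z where z: "z \<in> X \<delta>" "\<And>z'. z' \<in> X \<delta> \<Longrightarrow> ?F z \<le> ?F z'"
      using approximation_consistency_min_exists[OF \<delta> u l ld] by blast
    have zL: "z \<in> L2 \<Omega>" using z(1) X(2)[OF \<delta>] by blast
    have uz: "u - z \<in> L2 \<Omega>" using u zL subspace_L2[of \<Omega>] by (simp add: subspace_diff)
    have KB': "Hm2_nrm \<Omega> (opB \<Omega> (u - z)) \<le> KB * L2_nrm (u - z)"
      using H20_zero[OF \<delta>] KB uz L2_nrm_nonneg[of "u - z"] by (intro dual_norm_le H2_nrm_nonneg) auto
    define D where "D = data_error \<Omega> \<omega> u l q + \<epsilon> * L2_nrm u + ?F z"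
    have "L2_nrm (u - z) \<le> D"
      using data_error_nonneg[of u l q] consistency_error_nonneg[OF \<delta> zL l ld] \<epsilon> L2_nrm_nonneg[of u]
      by (simp add: D_def)
    then have "(KB + 1 + \<epsilon>0) * L2_nrm (u - z) \<le> (KB + 1 + \<epsilon>0) * D"
      using KB(1) \<epsilon> by (intro mult_left_mono) auto
    moreover have "(CQ + 2) * energy \<delta> \<epsilon> ld q (z - ud) 0 \<le> (CQ + 2) * (2 * (M * D))"
    proof (intro mult_left_mono)
      have "energy \<delta> \<epsilon> ld q z 1 \<le> M * D"
        unfolding M_def D_def by (rule energy_le_errors[OF \<delta> \<epsilon> zL u q l ld CE(1) CE(2)[OF \<delta>] KB(1) KB'])
      then show "energy \<delta> \<epsilon> ld q (z - ud) 0 \<le> 2 * (M * D)"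
        using energy_diff_le[OF \<delta> _ ld q ud z(1)] \<epsilon> by simp
    qed (use CQ(1) in simp)
    moreover have "total_error \<Omega> \<omega> \<epsilon> u ud
        \<le> (KB + 1 + \<epsilon>0) * L2_nrm (u - z) + (CQ + 2) * energy \<delta> \<epsilon> ld q (z - ud) 0"
      using ud is_minimizer_iff by (intro total_error_le_energy[OF \<delta> \<epsilon> u z(1) _ CQ(1) CQ(2)[OF \<delta>] KB']) auto
    ultimately have "total_error \<Omega> \<omega> \<epsilon> u ud \<le> (KB + 1 + \<epsilon>0 + (CQ + 2) * (2 * M)) * D"
      by (simp add: algebra_simps)
    also have "D = data_error \<Omega> \<omega> u l q + \<epsilon> * L2_nrm u + min_over (X \<delta>) ?F"
      by (simp only: D_def min_over_attained[of z _ ?F, OF z])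
    finally show "total_error \<Omega> \<omega> \<epsilon> u ud \<le> (KB + 1 + \<epsilon>0 + (CQ + 2) * (2 * M)) *
        (data_error \<Omega> \<omega> u l q + \<epsilon> * L2_nrm u + min_over (X \<delta>) ?F)" .
  qed
  then show ?thesis by blast
qed

text \<open>The minimum of the combined expression is at most its value at the best approximation of
  \<open>u\<close>, where the hypothesis bounds the consistency error. The constants
  \<open>K\<close> and \<open>C1\<close> come without a sign, hence the maxima with 0.\<close>

lemma oscillation_bound:
  assumes bound: "a_priori_bound \<Omega> \<omega> I X Y ip E B \<epsilon>0 K"
    and \<delta>: "\<delta> \<in> I" and \<epsilon>: "\<epsilon> \<in> {0..\<epsilon>0}" and l: "l \<in> Hm2 \<Omega>" and ld: "ld \<in> dual (Y \<delta>) (ip_norm (ip \<delta>))"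
    and q: "q \<in> L2 \<omega>" and u: "u \<in> L2 \<Omega>"
    and ud: "is_minimizer \<omega> (X \<delta>) (Y \<delta>) (ip \<delta>) (B \<delta>) \<epsilon> ld q ud" and osc: "0 \<le> osc"
    and cons: "\<And>z. z \<in> X \<delta> \<Longrightarrow> consistency_error (Y \<delta>) (ip \<delta>) (E \<delta>) (B \<delta>) l ld z
      \<le> C1 * (Hm2_nrm \<Omega> (\<lambda>v. l v - opB \<Omega> u v) + L2_nrm (u - z) + osc)"
  shows "total_error \<Omega> \<omega> \<epsilon> u ud \<le> max K 0 * (1 + max C1 0) *
    (data_error \<Omega> \<omega> u l q + min_over (X \<delta>) (\<lambda>z. L2_nrm (u - z)) + osc + \<epsilon> * L2_nrm u)"
proof -
  let ?c = "consistency_error (Y \<delta>) (ip \<delta>) (E \<delta>) (B \<delta>) l ld"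
  let ?F = "\<lambda>z. L2_nrm (u - z) + ?c z"
  obtain y where y: "y \<in> X \<delta>" "\<And>z'. z' \<in> X \<delta> \<Longrightarrow> ?F y \<le> ?F z'"
    using approximation_consistency_min_exists[OF \<delta> u l ld] by blast
  obtain z where z: "z \<in> X \<delta>" "\<And>z'. z' \<in> X \<delta> \<Longrightarrow> L2_nrm (u - z) \<le> L2_nrm (u - z')"
    using best_approximation_exists[OF \<delta> u] by blast
  have minF: "min_over (X \<delta>) ?F = ?F y" by (rule min_over_attained[of y _ ?F, OF y])
  have minm: "min_over (X \<delta>) (\<lambda>z. L2_nrm (u - z)) = L2_nrm (u - z)" by (rule min_over_attained[of z _ "\<lambda>z. L2_nrm (u - z)", OF z])
  define m D e r where "m = L2_nrm (u - z)" and "D = data_error \<Omega> \<omega> u l q" and "e = \<epsilon> * L2_nrm u"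
    and "r = Hm2_nrm \<Omega> (\<lambda>v. l v - opB \<Omega> u v)"
  have r: "r = Hm2_nrm \<Omega> (\<lambda>v. opB \<Omega> u v - l v)" unfolding r_def by (intro dual_norm_cong) simp
  have rD: "r \<le> D" unfolding r D_def data_error_def by (rule order_trans[OF abs_ge_self data_nrm_ge(1)])
  have r0: "0 \<le> r"
    unfolding r using H20_zero[OF \<delta>] bounded_functional_residual[OF \<delta> u l]
    by (intro dual_norm_nonneg H2_nrm_nonneg) auto
  have nn: "0 \<le> m" "0 \<le> D" "0 \<le> e"
    using L2_nrm_nonneg[of u] L2_nrm_nonneg[of "u - z"] data_error_nonneg \<epsilon> by (simp_all add: m_def D_def e_def)
  have yL: "y \<in> L2 \<Omega>" using y(1) X(2)[OF \<delta>] by blast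
  have F0: "0 \<le> ?F y" using L2_nrm_nonneg[of "u - y"] consistency_error_nonneg[OF \<delta> yL l ld] by simp
  have "?c z \<le> C1 * (r + m + osc)" using cons[OF z(1)] by (simp add: r_def m_def)
  also have "\<dots> \<le> max C1 0 * (r + m + osc)" using r0 nn osc by (intro mult_right_mono) auto
  also have "\<dots> \<le> max C1 0 * (D + m + osc + e)" using rD nn by (intro mult_left_mono) auto
  \<comment> \<open>Two minimisers are compared: \<open>y\<close> for the combined expression and
    \<open>z\<close> for the approximation error alone.\<close>
  finally have "?F y \<le> m + max C1 0 * (D + m + osc + e)" using y(2)[OF z(1)] by (simp add: m_def)
  then have le: "D + e + ?F y \<le> (1 + max C1 0) * (D + m + osc + e)" using osc by (simp add: distrib_right)
  have "total_error \<Omega> \<omega> \<epsilon> u ud \<le> K * (D + e + min_over (X \<delta>) ?F)"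
    using bound \<delta> \<epsilon> l ld q u ud unfolding a_priori_bound_def D_def e_def by blast
  also have "\<dots> \<le> max K 0 * (D + e + ?F y)"
    unfolding minF using nn F0 by (intro mult_right_mono) auto
  also have "\<dots> \<le> max K 0 * ((1 + max C1 0) * (D + m + osc + e))"
    using le by (intro mult_left_mono) auto
  finally show ?thesis unfolding minm by (simp only: m_def D_def e_def mult.assoc)
qed

end

text \<open>Placing \<open>\<kappa>\<close> outermost expresses that the constant in (b) depends on
  \<open>K\<close> and \<open>C1\<close> alone. Existence of minimisers is a separate conjunct, so
  that the estimates for arbitrary minimisers are not vacuous.\<close>

theorem theorem5p2:
  "\<exists>\<kappa> :: real \<Rightarrow> real \<Rightarrow> real.
     \<forall>(\<Omega> :: (real^'n) set) \<omega> (I :: 'i set) X Y ip E B Q \<epsilon>0.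
       nonconforming_tests \<Omega> \<omega> I X Y ip E B Q \<longrightarrow> 0 < \<epsilon>0 \<longrightarrow>
         (\<forall>\<delta>\<in>I. \<forall>\<epsilon>\<in>{0..\<epsilon>0}. \<forall>ld\<in>dual (Y \<delta>) (ip_norm (ip \<delta>)). \<forall>q\<in>L2 \<omega>.
            \<exists>ud. is_minimizer \<omega> (X \<delta>) (Y \<delta>) (ip \<delta>) (B \<delta>) \<epsilon> ld q ud) \<and>
         (\<exists>K. a_priori_bound \<Omega> \<omega> I X Y ip E B \<epsilon>0 K) \<and>
         (\<forall>K C1. a_priori_bound \<Omega> \<omega> I X Y ip E B \<epsilon>0 K \<longrightarrow>
            (\<forall>\<delta>\<in>I. \<forall>\<epsilon>\<in>{0..\<epsilon>0}. \<forall>l\<in>Hm2 \<Omega>. \<forall>ld\<in>dual (Y \<delta>) (ip_norm (ip \<delta>)). \<forall>q\<in>L2 \<omega>. \<forall>u\<in>L2 \<Omega>.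
             \<forall>ud (osc :: 'i \<Rightarrow> ('n aefun \<Rightarrow> real) \<Rightarrow> real).
               is_minimizer \<omega> (X \<delta>) (Y \<delta>) (ip \<delta>) (B \<delta>) \<epsilon> ld q ud \<longrightarrow>
               0 \<le> osc \<delta> l \<longrightarrow>
               (\<forall>z\<in>X \<delta>. consistency_error (Y \<delta>) (ip \<delta>) (E \<delta>) (B \<delta>) l ld z
                  \<le> C1 * (Hm2_nrm \<Omega> (\<lambda>v. l v - opB \<Omega> u v) + L2_nrm (u - z) + osc \<delta> l)) \<longrightarrow>
               total_error \<Omega> \<omega> \<epsilon> u ud
                 \<le> \<kappa> K C1 * (data_error \<Omega> \<omega> u l q + min_over (X \<delta>) (\<lambda>z. L2_nrm (u - z))
                              + osc \<delta> l + \<epsilon> * L2_nrm u)))"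
proof (intro exI[of _ "\<lambda>K C1. max K 0 * (1 + max C1 0)"] allI impI conjI ballI, goal_cases)
  case (1 \<Omega> \<omega> I X Y ip E B Q \<epsilon>0 \<delta> \<epsilon> ld q)
  then show ?case by (intro nonconforming_tests.minimizer_exists) auto
next
  case (2 \<Omega> \<omega> I X Y ip E B Q \<epsilon>0)
  from nonconforming_tests.a_priori_bound_exists[OF 2(1)] show ?case .
next
  case (3 \<Omega> \<omega> I X Y ip E B Q \<epsilon>0 K C1 \<delta> \<epsilon> l ld q u ud osc)
  from nonconforming_tests.oscillation_bound[OF 3(1,3-11)] 3(12) show ?case by blast
qed

end
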